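(* Let $F=Z^n+\sum_{k=0}^{n-2}a_k(X,Y)Z^k$ be a WT equation with $\overline F=Z^n$, and let $F^{(1)},F^{(2)},\dots$ be the equations obtained successively by following the algorithm described in the context (with any choice of directions, and as long as the multiplicity does not drop). Then there exists an integer $r\ge0$ such that, up to some transvection, every $\Gamma[k](F^{(r)})$ is a quadrant; that is, there is a single transvection $\varphi$ such that $\Gamma[k](\varphi(F^{(r)}))$ is a quadrant for every $k=0,\dots,n-2$.
   Context: $K$ is an algebraically closed field of characteristic $0$ and $\nu$ is the usual order function on power series. An embedded algebroid surface of multiplicity $n>1$ is $\mathcal S=\mathrm{Spec}(K[[X,Y,Z]]/(F))$ with $\nu(F)=n$; $F$ is called an equation of $\mathcal S$ and $\overline F$ is its initial form. A Weierstrass-Tchirnhausen (WT) equation is $F=Z^n+\sum_{k=0}^{n-2}a_k(X,Y)Z^k$ with $a_k=\sum_{i,j} a_{ijk}X^iY^j\in K[[X,Y]]$, $\nu(a_k)\ge n-k$. $\Gamma[k](F)$ is the Newton polyhedron of $a_k$: the convex hull of $\bigcup_{a_{ijk}\neq0}((i,j)+\mathbb Z_{\ge0}^2)$. It is a quadrant if it has only one vertex; the empty set is also considered a quadrant. A transvection is a change of coordinates $X\mapsto X$, $Y\mapsto Y+\sum_{i\ge1}\alpha_iX^i$, $Z\mapsto Z$ with $\alpha_i\in K$. A non-maximal prime ideal $\mathfrak p=(G,H)$ with $\nu(G)=\nu(H)=1$ is a permissible curve if $F\in\mathfrak p^n$. Algorithm: if $(Z,X)$ or $(Z,Y)$ is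 a permissible curve, make a monoidal transformation centered in it; otherwise perform a quadratic transformation. A quadratic transformation in the direction $(a:b:c)$ (a point of the tangent cone $\overline F=0$ in $\mathbb P^2(K)$) is given, say for $a\neq0$, by $X\mapsto X$, $Y\mapsto X(Y+b/a)$, $Z\mapsto X(Z+c/a)$, the new equation being the image of $F$ divided by $X^n$; in the direction $(0:1:0)$ by $X\mapsto XY$, $Y\mapsto Y$, $Z\mapsto YZ$, dividing by $Y^n$ (other directions with $b\ne0$ analogously). A monoidal transformation centered in $(Z,X)$ in the direction $(a:0:c)$, $a\ne0$, is $X\mapsto X$, $Y\mapsto Y$, $Z\mapsto X(Z+c/a)$, dividing by $X^n$; symmetrically for $(Z,Y)$. *)

theory Defs
  imports "HOL-Analysis.Analysis" "HOL-Computational_Algebra.Computational_Algebra"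
begin

text \<open>
  The ring \<open>K[[X,Y]]\<close> is the type \<open>'a fps fps\<close>, read as \<open>K[[X]][[Y]]\<close>, and \<open>K[[X,Y,Z]]\<close> is
  \<open>'a fps fps fps\<close>, read as \<open>K[[X]][[Y]][[Z]]\<close>: the outermost variable is \<open>Z\<close>, the innermost
  one is \<open>X\<close>. In particular \<open>fps_nth F k\<close> is the coefficient of \<open>Z^k\<close> in \<open>F\<close>,
  a series in \<open>X\<close> and \<open>Y\<close>.
\<close>

definition coeff2 :: "'a::zero fps fps \<Rightarrow> nat \<Rightarrow> nat \<Rightarrow> 'a" where
  "coeff2 f i j = fps_nth (fps_nth f j) i"

definition coeff3 :: "'a::zero fps fps fps \<Rightarrow> nat \<Rightarrow> nat \<Rightarrow> nat \<Rightarrow> 'a" where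
  "coeff3 F i j k = fps_nth (fps_nth (fps_nth F k) j) i"

definition series3 :: "(nat \<Rightarrow> nat \<Rightarrow> nat \<Rightarrow> 'a) \<Rightarrow> 'a fps fps fps" where
  "series3 c = Abs_fps (\<lambda>k. Abs_fps (\<lambda>j. Abs_fps (\<lambda>i. c i j k)))"

definition varX :: "'a::field fps fps fps" where
  "varX = fps_const (fps_const fps_X)"

definition varY :: "'a::field fps fps fps" where
  "varY = fps_const fps_X"

definition varZ :: "'a::field fps fps fps" where
  "varZ = fps_X"

definition const3 :: "'a::field \<Rightarrow> 'a fps fps fps" where
  "const3 c = fps_const (fps_const (fps_const c))"

text \<open>The order functions; the order of \<open>0\<close> is \<open>\<infinity>\<close>.\<close>

definition nu2 :: "'a::zero fps fps \<Rightarrow> enat" where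
  "nu2 f = Inf {enat (i + j) |i j. coeff2 f i j \<noteq> 0}"

definition nu3 :: "'a::zero fps fps fps \<Rightarrow> enat" where
  "nu3 F = Inf {enat (i + j + k) |i j k. coeff3 F i j k \<noteq> 0}"

text \<open>The multiplicity as a natural number; only meaningful for \<open>F \<noteq> 0\<close>.\<close>

definition mult3 :: "'a::zero fps fps fps \<Rightarrow> nat" where
  "mult3 F = the_enat (nu3 F)"

definition initial_form :: "'a::zero fps fps fps \<Rightarrow> 'a fps fps fps" where
  "initial_form F =
     series3 (\<lambda>i j k. if enat (i + j + k) = nu3 F then coeff3 F i j k else 0)"

text \<open>\<open>(a : b : c)\<close> is a point of the projective plane curve given by the initial form of \<open>F\<close>.\<close>

definition on_tangent_cone :: "'a::field fps fps fps \<Rightarrow> 'a \<Rightarrow> 'a \<Rightarrow> 'a \<Rightarrow> bool" where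
  "on_tangent_cone F a b c \<longleftrightarrow>
     (a, b, c) \<noteq> (0, 0, 0) \<and>
     (\<Sum>(i, j, k) \<in> {(i, j, k). i + j + k = mult3 F}.
        coeff3 (initial_form F) i j k * a ^ i * b ^ j * c ^ k) = 0"

text \<open>
  The image of \<open>F\<close> under the substitution \<open>X \<mapsto> P\<close>, \<open>Y \<mapsto> Q\<close>, \<open>Z \<mapsto> R\<close>, for \<open>P\<close>, \<open>Q\<close>, \<open>R\<close> without
  constant term. Since \<open>P^i Q^j R^k\<close> then has order at least \<open>i + j + k\<close>, only the finitely many
  monomials of \<open>F\<close> of degree at most \<open>u + v + w\<close> contribute to the coefficient of
  \<open>X^u Y^v Z^w\<close>, and these are the ones summed over.
\<close>

definition subst3 ::
  "'a::field fps fps fps \<Rightarrow> 'a fps fps fps \<Rightarrow> 'a fps fps fps \<Rightarrow> 'a fps fps fps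
     \<Rightarrow> 'a fps fps fps" where
  "subst3 P Q R F = series3 (\<lambda>u v w.
     (\<Sum>(i, j, k) \<in> {(i, j, k). i + j + k \<le> u + v + w}.
        coeff3 F i j k * coeff3 (P ^ i * Q ^ j * R ^ k) u v w))"

definition WT_equation :: "nat \<Rightarrow> 'a::field fps fps fps \<Rightarrow> bool" where
  "WT_equation n F \<longleftrightarrow>
     (\<exists>a :: nat \<Rightarrow> 'a fps fps.
        (\<forall>k \<le> n - 2. nu2 (a k) \<ge> enat (n - k)) \<and>
        F = varZ ^ n + (\<Sum>k = 0..n - 2. fps_const (a k) * varZ ^ k))"

subsection \<open>Newton polyhedra and transvections\<close>

definition newton_polyhedron :: "'a::zero fps fps \<Rightarrow> (real \<times> real) set" where
  "newton_polyhedron f =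
     convex hull (\<Union>(i, j) \<in> {(i, j). coeff2 f i j \<noteq> 0}.
       {(real (i + p), real (j + q)) |p q. True})"

definition Gamma_polyhedron :: "nat \<Rightarrow> 'a::zero fps fps fps \<Rightarrow> (real \<times> real) set" where
  "Gamma_polyhedron k F = newton_polyhedron (fps_nth F k)"

definition quadrant :: "(real \<times> real) set \<Rightarrow> bool" where
  "quadrant S \<longleftrightarrow> S = {} \<or> (\<exists>!v. v extreme_point_of S)"

definition transvection :: "('a::field fps fps fps \<Rightarrow> 'a fps fps fps) \<Rightarrow> bool" where
  "transvection \<phi> \<longleftrightarrow>
     (\<exists>\<alpha> :: 'a fps. fps_nth \<alpha> 0 = 0 \<and>
        \<phi> = subst3 varX (varY + fps_const (fps_const \<alpha>)) varZ)"

subsection \<open>Permissible curves\<close>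

definition is_ideal :: "'r::comm_ring_1 set \<Rightarrow> bool" where
  "is_ideal I \<longleftrightarrow> 0 \<in> I \<and> (\<forall>x\<in>I. \<forall>y\<in>I. x + y \<in> I) \<and> (\<forall>x\<in>I. \<forall>r. r * x \<in> I)"

definition prime_ideal :: "'r::comm_ring_1 set \<Rightarrow> bool" where
  "prime_ideal I \<longleftrightarrow>
     is_ideal I \<and> I \<noteq> UNIV \<and> (\<forall>x y. x * y \<in> I \<longrightarrow> x \<in> I \<or> y \<in> I)"

definition maximal_ideal :: "'r::comm_ring_1 set \<Rightarrow> bool" where
  "maximal_ideal I \<longleftrightarrow>
     is_ideal I \<and> I \<noteq> UNIV \<and> (\<forall>J. is_ideal J \<and> I \<subseteq> J \<longrightarrow> J = I \<or> J = UNIV)"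

definition ideal_power :: "'r::comm_ring_1 set \<Rightarrow> nat \<Rightarrow> 'r set" where
  "ideal_power I n = is_ideal hull {prod_list xs |xs. length xs = n \<and> set xs \<subseteq> I}"

definition permissible_curve ::
  "'a::field fps fps fps \<Rightarrow> 'a fps fps fps \<Rightarrow> 'a fps fps fps \<Rightarrow> bool" where
  "permissible_curve F G H \<longleftrightarrow>
     nu3 G = 1 \<and> nu3 H = 1 \<and>
     prime_ideal (is_ideal hull {G, H}) \<and> \<not> maximal_ideal (is_ideal hull {G, H}) \<and>
     F \<in> ideal_power (is_ideal hull {G, H}) (mult3 F)"

subsection \<open>The algorithm\<close>

text \<open>
  In the relations below \<open>F'\<close> is the new equation, that is, the image of \<open>F\<close> under the substitution
  divided by the appropriate power of the exceptional variable. The chart is determined by the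
  direction: the one with exceptional divisor \<open>X = 0\<close> whenever \<open>a \<noteq> 0\<close>, the one with exceptional
  divisor \<open>Y = 0\<close> only when \<open>a = 0\<close> and \<open>b \<noteq> 0\<close>. The direction \<open>(0 : 0 : 1)\<close> is left out: it is not
  on the tangent cone of an equation of multiplicity \<open>n\<close> in which \<open>Z^n\<close> has coefficient \<open>1\<close>, and
  the transformations below keep this coefficient.
\<close>

definition quadratic_transform ::
  "'a::field fps fps fps \<Rightarrow> 'a fps fps fps \<Rightarrow> bool" where
  "quadratic_transform F F' \<longleftrightarrow>
     (\<exists>a b c. on_tangent_cone F a b c \<and>
        (a \<noteq> 0 \<and>
         varX ^ mult3 F * F' =
           subst3 varX (varX * (varY + const3 (b / a))) (varX * (varZ + const3 (c / a))) F
       \<or> a = 0 \<and> b \<noteq> 0 \<and>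
         varY ^ mult3 F * F' =
           subst3 (varX * varY) varY (varY * (varZ + const3 (c / b))) F))"

definition monoidal_transform_ZX ::
  "'a::field fps fps fps \<Rightarrow> 'a fps fps fps \<Rightarrow> bool" where
  "monoidal_transform_ZX F F' \<longleftrightarrow>
     (\<exists>a c. on_tangent_cone F a 0 c \<and> a \<noteq> 0 \<and>
        varX ^ mult3 F * F' = subst3 varX varY (varX * (varZ + const3 (c / a))) F)"

definition monoidal_transform_ZY ::
  "'a::field fps fps fps \<Rightarrow> 'a fps fps fps \<Rightarrow> bool" where
  "monoidal_transform_ZY F F' \<longleftrightarrow>
     (\<exists>b c. on_tangent_cone F 0 b c \<and> b \<noteq> 0 \<and>
        varY ^ mult3 F * F' = subst3 varX varY (varY * (varZ + const3 (c / b))) F)"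

definition algorithm_step ::
  "'a::field fps fps fps \<Rightarrow> 'a fps fps fps \<Rightarrow> bool" where
  "algorithm_step F F' \<longleftrightarrow>
     (permissible_curve F varZ varX \<and> monoidal_transform_ZX F F') \<or>
     (permissible_curve F varZ varY \<and> monoidal_transform_ZY F F') \<or>
     (\<not> permissible_curve F varZ varX \<and> \<not> permissible_curve F varZ varY \<and>
      quadratic_transform F F')"

end

theory Submission
  imports Defs
begin

text \<open>
  Since \<open>F\<close> has no term in \<open>Z^(n-1)\<close> and the multiplicity stays \<open>n\<close>, the direction of every step has
  vanishing \<open>Z\<close>-component: a component \<open>c\<close> would create the coefficient \<open>n c\<close> of \<open>Z^(n-1)\<close>, a term of
  degree below \<open>n\<close> in the new equation, and the characteristic is \<open>0\<close> (\<open>direction_Z_zero\<close>). Hence the equations keep the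
  shape \<open>Z^n + \<Sum> a\<^sub>k Z^k\<close> with \<open>k \<le> n - 2\<close>, and each step replaces all the \<open>a\<^sub>k\<close> simultaneously: with
  \<open>N = n - k\<close>, by \<open>a\<^sub>k / X^N\<close>, by \<open>a\<^sub>k / Y^N\<close>, by \<open>a\<^sub>k(X, X(Y + b)) / X^N\<close> or by \<open>a\<^sub>k(XY, Y) / Y^N\<close>
  (\<open>algorithm_step_acts\<close>). What has to be shown is embedded resolution of finitely many plane curve
  germs \<open>a\<^sub>k = 0\<close> along a sequence of infinitely near points, where monomial factors may be divided off
  in between.
  
  Write a nonzero \<open>a\<^sub>k\<close> as \<open>X^p Y^q g\<close> with \<open>g\<close> divisible neither by \<open>X\<close> nor by \<open>Y\<close>. The order \<open>m\<^sub>k\<close> of the strict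
  part \<open>g\<close> never increases (\<open>acts_strict_order_le\<close>), so eventually all \<open>m\<^sub>k\<close> are constant. If they are
  all \<open>0\<close>, every nonzero \<open>a\<^sub>k\<close> is a monomial times a unit. Suppose that some \<open>m\<^sub>k\<close> stays positive. The
  steps other than those with \<open>b \<noteq> 0\<close> decrease the pair consisting of the intersection number of
  \<open>g\<close> with \<open>XY = 0\<close> and the order of \<open>a\<^sub>k\<close> (\<open>monomial_move_decreases\<close>), so that a step
  with \<open>b \<noteq> 0\<close> must come. After it, \<open>q = 0\<close> and \<open>X^p Y^m\<close> with \<open>m = m\<^sub>k\<close> is a monomial of
  \<open>a\<^sub>k\<close>, for every nonzero \<open>a\<^sub>k\<close>; this state persists and forces all later quadratic
  transformations into the \<open>X\<close>-chart.
  
  From that moment on the directions \<open>b\<^sub>1, b\<^sub>2, \<dots>\<close> of the quadratic transformations are the coefficients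
  of a series \<open>\<beta> = b\<^sub>1 X + b\<^sub>2 X^2 + \<dots>\<close>, and the transvection \<open>Y \<mapsto> Y + \<beta>\<close> turns all further steps
  into \<open>b = 0\<close> (\<open>shearY_chartX\<close>). Under these a monomial \<open>X^i Y^j\<close> of the sheared series has its distance
  \<open>i - p\<close> to the exceptional divisor changed by \<open>j - m\<close> in each quadratic transformation. This
  distance is never negative, and quadratic transformations recur, since the monoidal ones lower the order
  of \<open>a\<^sub>k\<close>; so \<open>j \<ge> m\<close> for all monomials (\<open>sheared_limit_monomial\<close>), and the Newton
  polyhedron is the quadrant with vertex \<open>(p, m)\<close>.
\<close>

section \<open>Orders of bivariate power series\<close>

text \<open>
  A series in \<open>X\<close> and \<open>Y\<close> is handled as its family of coefficients, \<open>f i j\<close> belonging to \<open>X^i Y^j\<close>.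
  Statements are made for the variable \<open>X\<close>; those for \<open>Y\<close> follow by interchanging the variables.
  Below, \<open>chartX b f\<close> is the series \<open>f(X, X(Y + b))\<close>.
\<close>

definition mulX :: "nat \<Rightarrow> (nat \<Rightarrow> nat \<Rightarrow> 'a::zero) \<Rightarrow> nat \<Rightarrow> nat \<Rightarrow> 'a" where
  "mulX N f i j = (if N \<le> i then f (i - N) j else 0)"

definition swap :: "(nat \<Rightarrow> nat \<Rightarrow> 'a) \<Rightarrow> nat \<Rightarrow> nat \<Rightarrow> 'a" where
  "swap f i j = f j i"

definition chartX :: "'a::field \<Rightarrow> (nat \<Rightarrow> nat \<Rightarrow> 'a) \<Rightarrow> nat \<Rightarrow> nat \<Rightarrow> 'a" where
  "chartX b f d l = (\<Sum>j\<le>d. f (d - j) j * of_nat (j choose l) * b ^ (j - l))"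

definition nonzero :: "(nat \<Rightarrow> nat \<Rightarrow> 'a::zero) \<Rightarrow> bool" where
  "nonzero f \<longleftrightarrow> (\<exists>i j. f i j \<noteq> 0)"

definition ordX :: "(nat \<Rightarrow> nat \<Rightarrow> 'a::zero) \<Rightarrow> nat" where
  "ordX f = (LEAST i. \<exists>j. f i j \<noteq> 0)"

definition ordY :: "(nat \<Rightarrow> nat \<Rightarrow> 'a::zero) \<Rightarrow> nat" where
  "ordY f = (LEAST j. \<exists>i. f i j \<noteq> 0)"

definition ord2 :: "(nat \<Rightarrow> nat \<Rightarrow> 'a::zero) \<Rightarrow> nat" where
  "ord2 f = (LEAST d. \<exists>i j. i + j = d \<and> f i j \<noteq> 0)"

text \<open>
  The order of \<open>g\<close> in \<open>f = X^p Y^q g\<close>, with \<open>g\<close> divisible neither by \<open>X\<close> nor by \<open>Y\<close>. The two quantities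
  that follow are the intersection numbers of \<open>g = 0\<close> with \<open>Y = 0\<close> and with \<open>X = 0\<close>.
\<close>

definition strict_order :: "(nat \<Rightarrow> nat \<Rightarrow> 'a::zero) \<Rightarrow> nat" where
  "strict_order f = ord2 f - (ordX f + ordY f)"

definition width :: "(nat \<Rightarrow> nat \<Rightarrow> 'a::zero) \<Rightarrow> nat" where
  "width f = (LEAST i. f i (ordY f) \<noteq> 0) - ordX f"

definition height :: "(nat \<Rightarrow> nat \<Rightarrow> 'a::zero) \<Rightarrow> nat" where
  "height f = (LEAST j. f (ordX f) j \<noteq> 0) - ordY f"

lemma swap_swap [simp]: "swap (swap f) = f"
  by (simp add: swap_def fun_eq_iff)

lemma nonzero_swap [simp]: "nonzero (swap f) = nonzero f"
  by (auto simp: nonzero_def swap_def)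

lemma ordX_swap [simp]: "ordX (swap f) = ordY f" and ordY_swap [simp]: "ordY (swap f) = ordX f"
  by (simp_all add: ordX_def ordY_def swap_def)

lemma ord2_swap [simp]: "ord2 (swap f) = ord2 f"
proof -
  have "(\<lambda>d. \<exists>i j. i + j = d \<and> f j i \<noteq> 0) = (\<lambda>d. \<exists>i j. i + j = d \<and> f i j \<noteq> 0)"
    by (intro ext) (blast intro: add.commute)
  then show ?thesis by (simp add: ord2_def swap_def)
qed

lemma strict_order_swap [simp]: "strict_order (swap f) = strict_order f"
  by (simp add: strict_order_def add.commute)

lemma width_swap [simp]: "width (swap f) = height f" and height_swap [simp]: "height (swap f) = width f"
  by (simp_all add: width_def height_def) (simp_all add: swap_def)

lemma ordX_le: "f i j \<noteq> 0 \<Longrightarrow> ordX f \<le> i"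
  unfolding ordX_def by (rule Least_le) blast

lemma ordY_le: "f i j \<noteq> 0 \<Longrightarrow> ordY f \<le> j"
  unfolding ordY_def by (rule Least_le) blast

lemma ord2_le: "f i j \<noteq> 0 \<Longrightarrow> ord2 f \<le> i + j"
  unfolding ord2_def by (rule Least_le) blast

lemma ordX_attained: assumes "nonzero f" shows "\<exists>j. f (ordX f) j \<noteq> 0"
  using assms unfolding nonzero_def ordX_def by (rule LeastI_ex)

lemma ordY_attained: assumes "nonzero f" shows "\<exists>i. f i (ordY f) \<noteq> 0"
  using ordX_attained [of "swap f"] assms by (simp add: swap_def)

lemma ord2_attained: assumes "nonzero f" shows "\<exists>i j. i + j = ord2 f \<and> f i j \<noteq> 0"
proof -
  have "\<exists>d i j. i + j = d \<and> f i j \<noteq> 0" using assms by (auto simp: nonzero_def)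
  then show ?thesis unfolding ord2_def by (rule LeastI_ex)
qed

lemma ordX_eqI: "f p j \<noteq> 0 \<Longrightarrow> (\<And>i j. f i j \<noteq> 0 \<Longrightarrow> p \<le> i) \<Longrightarrow> ordX f = p"
  unfolding ordX_def by (rule Least_equality) auto

lemma ordY_eqI: "f i q \<noteq> 0 \<Longrightarrow> (\<And>i j. f i j \<noteq> 0 \<Longrightarrow> q \<le> j) \<Longrightarrow> ordY f = q"
  unfolding ordY_def by (rule Least_equality) auto

lemma ord2_decomp:
  assumes "nonzero f" shows "ord2 f = ordX f + ordY f + strict_order f"
proof -
  obtain i j where "i + j = ord2 f" "f i j \<noteq> 0" using ord2_attained [OF assms] by blast
  with ordX_le [of f i j] ordY_le [of f i j] show ?thesis
    unfolding strict_order_def by linarith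
qed

lemma width_attained:
  assumes "nonzero f" shows "f (ordX f + width f) (ordY f) \<noteq> 0"
proof -
  let ?A = "LEAST i. f i (ordY f) \<noteq> 0"
  have "f ?A (ordY f) \<noteq> 0" using ordY_attained [OF assms] by (rule LeastI_ex)
  moreover from ordX_le [of f ?A "ordY f", OF this] have "?A = ordX f + width f" by (simp add: width_def)
  ultimately show ?thesis by simp
qed

lemma width_le:
  assumes "f i (ordY f) \<noteq> 0" shows "ordX f + width f \<le> i"
proof -
  have n: "nonzero f" using assms by (auto simp: nonzero_def)
  let ?A = "LEAST i. f i (ordY f) \<noteq> 0"
  have "f ?A (ordY f) \<noteq> 0" using ordY_attained [OF n] by (rule LeastI_ex)
  moreover from ordX_le [of f ?A "ordY f", OF this] have "?A = ordX f + width f" by (simp add: width_def)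
  moreover have "?A \<le> i" using assms by (rule Least_le)
  ultimately show ?thesis by simp
qed

lemma height_attained:
  assumes "nonzero f" shows "f (ordX f) (ordY f + height f) \<noteq> 0"
  using width_attained [of "swap f"] assms by (simp, simp add: swap_def)

lemma height_le:
  assumes "f (ordX f) j \<noteq> 0" shows "ordY f + height f \<le> j"
  using width_le [of "swap f" j] assms by (simp, simp add: swap_def)

lemma strict_order_le_height:
  assumes "nonzero f" shows "strict_order f \<le> height f"
  using ord2_le [of f "ordX f" "ordY f + height f", OF height_attained [OF assms]] ord2_decomp [OF assms] by simp

lemma mulX_eqD:
  assumes "f = mulX N f'"
  shows "f' i j = f (i + N) j" "f i j \<noteq> 0 \<Longrightarrow> N \<le> i"
  by (simp_all add: assms mulX_def split: if_splits)

text \<open>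
  A monoidal transformation leaves the strict part untouched.
\<close>

lemma monomial_factor_invariants:
  assumes e: "f = mulX N f'" and nz: "nonzero f"
  shows "nonzero f'" "ordX f = ordX f' + N" "ordY f' = ordY f" "ord2 f = ord2 f' + N"
    "strict_order f' = strict_order f" "width f' = width f" "height f' = height f"
proof -
  note D = mulX_eqD [OF e]
  from nz obtain i j where "f i j \<noteq> 0" by (auto simp: nonzero_def)
  then have "f' (i - N) j \<noteq> 0" using D by auto
  then show n': "nonzero f'" by (auto simp: nonzero_def)
  obtain j where j: "f' (ordX f') j \<noteq> 0" using ordX_attained [OF n'] by blast
  show X: "ordX f = ordX f' + N"
  proof (rule ordX_eqI)
    show "f (ordX f' + N) j \<noteq> 0" using j D by simp
    fix i j assume "f i j \<noteq> 0"
    with D(2)[OF this] have "f' (i - N) j \<noteq> 0" "N \<le> i" by (simp_all add: D(1))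
    with ordX_le [of f' "i - N" j] show "ordX f' + N \<le> i" by simp
  qed
  obtain i where i: "f i (ordY f) \<noteq> 0" using ordY_attained [OF nz] by blast
  show Y: "ordY f' = ordY f"
  proof (rule ordY_eqI)
    show "f' (i - N) (ordY f) \<noteq> 0" using i D by simp
    fix i j assume "f' i j \<noteq> 0"
    then show "ordY f \<le> j" using D ordY_le by metis
  qed
  obtain i j where ij: "i + j = ord2 f" "f i j \<noteq> 0" using ord2_attained [OF nz] by blast
  obtain i' j' where ij': "i' + j' = ord2 f'" "f' i' j' \<noteq> 0" using ord2_attained [OF n'] by blast
  have "ord2 f \<le> i' + N + j'" using ij' D by (intro ord2_le) auto
  moreover have "ord2 f' \<le> (i - N) + j" using ij D by (intro ord2_le) auto
  moreover have "N \<le> i" using ij D by blast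
  ultimately show O: "ord2 f = ord2 f' + N" using ij ij' by linarith
  then show "strict_order f' = strict_order f" using X Y by (simp add: strict_order_def)
  have w: "f (ordX f + width f) (ordY f) \<noteq> 0" using width_attained nz by blast
  have w': "f' (ordX f' + width f') (ordY f') \<noteq> 0" using width_attained n' by blast
  have "f' (ordX f' + width f) (ordY f') \<noteq> 0" using w D X Y by (simp add: algebra_simps)
  then have "width f' \<le> width f" using width_le [of f'] by fastforce
  moreover have "f (ordX f + width f') (ordY f) \<noteq> 0" using w' D X Y by (simp add: algebra_simps)
  then have "width f \<le> width f'" using width_le [of f] by fastforce
  ultimately show "width f' = width f" by simp
  have "f' (ordX f') = f (ordX f)" using D X by auto
  then show "height f' = height f" using Y by (simp add: height_def)
qed

section \<open>Quadratic transformations\<close>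

text \<open>
  The homogeneous part of degree \<open>d\<close>, dehomogenised by \<open>X = 1\<close>. In \<open>f(X, X(Y + b))\<close> the coefficient
  of \<open>X^d\<close> is this polynomial at \<open>Y + b\<close>, which reduces quadratic transformations to univariate
  polynomials.
\<close>

definition form_poly :: "(nat \<Rightarrow> nat \<Rightarrow> 'a::field) \<Rightarrow> nat \<Rightarrow> 'a poly" where
  "form_poly f d = (\<Sum>j\<le>d. monom (f (d - j) j) j)"

lemma coeff_form_poly: "coeff (form_poly f d) j = (if j \<le> d then f (d - j) j else 0)"
proof -
  have "coeff (form_poly f d) j = (\<Sum>i\<le>d. if i = j then f (d - i) i else 0)"
    unfolding form_poly_def coeff_sum by (rule sum.cong) auto
  then show ?thesis by (simp add: sum.delta)
qed

lemma coeff_linear_power_binomial: "coeff ([:b, 1:] ^ j) l = of_nat (j choose l) * (b::'a::field) ^ (j - l)"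
proof (cases "l \<le> j")
  case True then show ?thesis by (simp add: coeff_linear_poly_power)
next
  case False
  then have "degree ([:b, 1:] ^ j) < l" by (simp add: degree_linear_power)
  then show ?thesis using False by (simp add: coeff_eq_0 binomial_eq_0)
qed

lemma chartX_eq_coeff: "chartX b f d l = coeff (pcompose (form_poly f d) [:b, 1:]) l"
proof -
  have "pcompose (form_poly f d) [:b, 1:] = (\<Sum>j\<le>d. smult (f (d - j) j) ([:b, 1:] ^ j))"
    unfolding form_poly_def pcompose_sum
  proof (rule sum.cong)
    fix j
    have "monom (f (d - j) j) j = smult (f (d - j) j) ([:0, 1:] ^ j)" by (simp add: monom_altdef)
    moreover have "pcompose ([:0, 1:] ^ j) [:b, 1:] = [:b, 1:] ^ j"
      by (induct j) (simp_all add: pcompose_mult pcompose_1 pcompose_pCons)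
    ultimately show "pcompose (monom (f (d - j) j) j) [:b, 1:] = smult (f (d - j) j) ([:b, 1:] ^ j)"
      by (simp add: pcompose_smult)
  qed simp
  then show ?thesis by (simp add: coeff_sum coeff_linear_power_binomial chartX_def mult.assoc)
qed

text \<open>
  The order of \<open>P(Y + b)\<close> at \<open>0\<close> is the multiplicity of the root \<open>b\<close> in \<open>P = Y^q R\<close>. As \<open>b \<noteq> 0\<close>,
  only \<open>R\<close> contributes to it.
\<close>

lemma shift_low_coeff:
  fixes P :: "'a::field poly"
  assumes "R \<noteq> 0" "P = monom 1 q * R" and "degree R \<le> e" "b \<noteq> 0"
  shows "\<exists>l\<le>e. coeff (pcompose P [:b, 1:]) l \<noteq> 0"
proof (rule ccontr)
  assume "\<not> ?thesis"
  then have "monom 1 (Suc e) dvd pcompose P [:b, 1:]" by (auto simp: monom_1_dvd_iff')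
  then obtain S where "pcompose P [:b, 1:] = monom 1 (Suc e) * S" by (auto simp: dvd_def)
  then have "pcompose (pcompose P [:b, 1:]) [:-b, 1:] = pcompose ([:0, 1:] ^ Suc e) [:-b, 1:] * pcompose S [:-b, 1:]"
    by (simp add: pcompose_mult monom_altdef del: power_Suc mult_pCons_left)
  moreover have "pcompose ([:0, 1:] ^ k) [:-b, 1:] = [:-b, 1:] ^ k" for k
    by (induct k) (simp_all add: pcompose_mult pcompose_1 pcompose_pCons)
  moreover have "pcompose (pcompose P [:b, 1:]) [:-b, 1:] = P"
    by (simp add: pcompose_assoc [symmetric] pcompose_pCons)
  ultimately have dvd: "[:-b, 1:] ^ Suc e dvd P" by (metis dvd_triv_left)
  have "P \<noteq> 0" using assms by (simp add: monom_eq_0_iff)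
  then have "Suc e \<le> Polynomial.order b P" using dvd by (simp only: order_divides simp_thms)
  also have "\<dots> = Polynomial.order b (monom 1 q) + Polynomial.order b R"
    using \<open>P \<noteq> 0\<close> assms(2) order_mult by blast
  also have "Polynomial.order b (monom 1 q) = 0"
    using \<open>b \<noteq> 0\<close> by (intro order_0I) (simp add: poly_monom)
  also have "Polynomial.order b R \<le> degree R" using \<open>R \<noteq> 0\<close> by (rule order_degree)
  finally show False using assms by simp
qed

lemma chartX_0: "chartX 0 f d l = (if l \<le> d then f (d - l) l else 0)"
  by (simp add: chartX_eq_coeff coeff_form_poly)

lemma chartX_row_nonzero_iff: "(\<exists>l. chartX b f d l \<noteq> 0) \<longleftrightarrow> (\<exists>j\<le>d. f (d - j) j \<noteq> 0)"
proof -
  have "(\<exists>l. chartX b f d l \<noteq> 0) \<longleftrightarrow> pcompose (form_poly f d) [:b, 1:] \<noteq> 0"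
    by (simp add: chartX_eq_coeff poly_eq_iff)
  also have "\<dots> \<longleftrightarrow> form_poly f d \<noteq> 0" by (simp add: pcompose_eq_0_iff)
  also have "\<dots> \<longleftrightarrow> (\<exists>j\<le>d. f (d - j) j \<noteq> 0)" by (auto simp: poly_eq_iff coeff_form_poly)
  finally show ?thesis .
qed

text \<open>
  The lowest power of \<open>X\<close> in \<open>f(X, X(Y + b))\<close> comes from the initial form of \<open>f\<close>, which is \<open>X^p Y^q\<close>
  times a form of degree \<open>m\<close>, the strict order. The multiplicity of the root \<open>b\<close> in the latter bounds the
  new strict order by \<open>m\<close>. If the bound is attained, the form of degree \<open>m\<close> is a power of a linear one,
  so the new exceptional curve meets the new strict part with multiplicity exactly \<open>m\<close>, and for \<open>b \<noteq> 0\<close> the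
  old factor \<open>Y^q\<close> has become a unit.
\<close>

lemma quadratic_invariants:
  assumes e: "chartX b f = mulX N f'" and nz: "nonzero f"
  shows "nonzero f'" "ordX f' + N = ord2 f" "strict_order f' \<le> strict_order f"
    "b = 0 \<Longrightarrow> ordY f' = ordY f"
    "strict_order f' = strict_order f \<Longrightarrow> height f' = strict_order f"
    "strict_order f' = strict_order f \<Longrightarrow> b \<noteq> 0 \<Longrightarrow> ordY f' = 0"
    "strict_order f' = strict_order f \<Longrightarrow> b = 0 \<Longrightarrow> width f' + strict_order f \<le> width f"
proof -
  note D = mulX_eqD [OF e]
  let ?d = "ord2 f" and ?q = "ordY f" and ?m = "strict_order f"
  have dec: "?d = ordX f + ?q + ?m" using ord2_decomp [OF nz] .
  obtain i0 j0 where ij0: "i0 + j0 = ?d" "f i0 j0 \<noteq> 0" using ord2_attained [OF nz] by blast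
  then have ij0': "j0 \<le> ?d" "f (?d - j0) j0 \<noteq> 0" by (metis le_add2, metis add_diff_cancel_right')
  have row: "\<exists>l. chartX b f ?d l \<noteq> 0"
    unfolding chartX_row_nonzero_iff using ij0' by blast
  have low: "?d \<le> d" if "chartX b f d l \<noteq> 0" for d l
  proof -
    have "\<exists>l. chartX b f d l \<noteq> 0" using that by blast
    then obtain j where "j \<le> d" "f (d - j) j \<noteq> 0" unfolding chartX_row_nonzero_iff by blast
    then show ?thesis using ord2_le [of f "d - j" j] by simp
  qed
  have Nd: "N \<le> ?d" using row D by blast
  obtain l where l: "f' (?d - N) l \<noteq> 0" using row D Nd by auto
  then show n': "nonzero f'" by (auto simp: nonzero_def)
  have X: "ordX f' = ?d - N"
  proof (rule ordX_eqI [of f' _ l, OF l])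
    fix i j assume "f' i j \<noteq> 0"
    then show "?d - N \<le> i" using D low by (metis le_diff_conv)
  qed
  then show X': "ordX f' + N = ?d" using Nd by simp
  show Y: "ordY f' = ?q" if "b = 0"
  proof -
    obtain i where i: "f i ?q \<noteq> 0" using ordY_attained [OF nz] by blast
    then have c: "chartX b f (i + ?q) ?q \<noteq> 0" by (simp add: that chartX_0)
    show ?thesis
    proof (rule ordY_eqI)
      show "f' (i + ?q - N) ?q \<noteq> 0" using c D by (metis le_add_diff_inverse2)
      fix i j assume "f' i j \<noteq> 0"
      then have "chartX b f (i + N) j \<noteq> 0" using D by simp
      then show "?q \<le> j" using that ordY_le by (metis chartX_0)
    qed
  qed
  have supp: "coeff (form_poly f ?d) j \<noteq> 0 \<Longrightarrow> ?q \<le> j \<and> j \<le> ?q + ?m" for j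
  proof -
    assume "coeff (form_poly f ?d) j \<noteq> 0"
    then have "j \<le> ?d" "f (?d - j) j \<noteq> 0" by (auto simp: coeff_form_poly split: if_splits)
    then show ?thesis using ordX_le [of f "?d - j" j] ordY_le [of f "?d - j" j] dec by linarith
  qed
  \<comment> \<open>For \<open>b = 0\<close> the factor \<open>Y^q\<close> of the initial form adds \<open>q\<close> to the multiplicity of the root.\<close>
  let ?e = "if b = 0 then ?q + ?m else ?m"
  have "\<exists>l\<le>?e. chartX b f ?d l \<noteq> 0"
  proof (cases "b = 0")
    case True
    have "j0 \<le> ?q + ?m" using supp [of j0] ij0' by (auto simp: coeff_form_poly)
    moreover have "chartX b f ?d j0 \<noteq> 0" using ij0' True by (auto simp: chartX_0)
    ultimately show ?thesis using True by auto
  next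
    case False
    have "monom 1 ?q dvd form_poly f ?d"
      unfolding monom_1_dvd_iff' using supp by (meson leD)
    then obtain R where R: "form_poly f ?d = monom 1 ?q * R" by (auto simp: dvd_def)
    have "form_poly f ?d \<noteq> 0" using row by (auto simp: chartX_eq_coeff)
    then have "R \<noteq> 0" using R by auto
    moreover have "degree R \<le> ?m"
    proof (rule degree_le, intro allI impI)
      fix i assume "?m < i"
      then have "coeff (form_poly f ?d) (?q + i) = 0" using supp [of "?q + i"] by fastforce
      then show "coeff R i = 0" by (simp add: R coeff_monom_mult)
    qed
    ultimately show ?thesis
      using shift_low_coeff [OF _ R _ False] False by (auto simp: chartX_eq_coeff)
  qed
  then obtain t where t: "t \<le> ?e" "f' (ordX f') t \<noteq> 0" using D Nd X by auto
  have tY: "ordY f' + height f' \<le> t" using height_le t(2) by blast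
  have mh: "strict_order f' \<le> height f'" using strict_order_le_height n' by blast
  show m': "strict_order f' \<le> ?m" using t tY mh Y by (auto split: if_splits)
  assume eq: "strict_order f' = ?m"
  show "height f' = ?m" using t tY mh Y eq by (auto split: if_splits)
  show "b \<noteq> 0 \<Longrightarrow> ordY f' = 0" using t tY mh Y eq by (auto split: if_splits)
  assume b: "b = 0"
  let ?w = "ordX f + width f"
  have w: "f ?w ?q \<noteq> 0" using width_attained nz by blast
  then have c: "chartX b f (?w + ?q) ?q \<noteq> 0" by (simp add: b chartX_0)
  then have "f' (?w + ?q - N) (ordY f') \<noteq> 0" using D Y b by (metis le_add_diff_inverse2)
  from width_le [of f' "?w + ?q - N", OF this] have "ordX f' + width f' \<le> ?w + ?q - N" .
  moreover have "N \<le> ?w + ?q" using c D by blast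
  ultimately show "width f' + ?m \<le> width f" using X' dec by linarith
qed

section \<open>Shearing along a branch\<close>

text \<open>
  The series \<open>f(X, Y + \<beta>(X))\<close>. For \<open>\<beta>\<close> without constant term \<open>\<beta>^t\<close> has order at least \<open>t\<close>, so that
  truncating the sum over \<open>t\<close> at \<open>u\<close> loses nothing.
\<close>

definition shearY :: "'a::field fps \<Rightarrow> (nat \<Rightarrow> nat \<Rightarrow> 'a) \<Rightarrow> nat \<Rightarrow> nat \<Rightarrow> 'a" where
  "shearY \<beta> f u v = (\<Sum>i\<le>u. \<Sum>t\<le>u. f i (v + t) * of_nat ((v + t) choose v) * fps_nth (\<beta> ^ t) (u - i))"

lemma power_coeff_low: "fps_nth (\<beta>::'a::field fps) 0 = 0 \<Longrightarrow> m < t \<Longrightarrow> fps_nth (\<beta> ^ t) m = 0"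
  using startsby_zero_power_prefix by blast

lemma power_coeff_nonzeroD:
  "fps_nth ((\<beta>::'a::field fps) ^ t) (u - i) \<noteq> 0 \<Longrightarrow> fps_nth \<beta> 0 = 0 \<Longrightarrow> i \<le> u \<Longrightarrow> i + t \<le> u"
  using power_coeff_low [of \<beta> "u - i" t] by linarith

lemma shearY_bound:
  assumes "fps_nth \<beta> 0 = 0" "u \<le> M"
  shows "shearY \<beta> f u v = (\<Sum>i\<le>u. \<Sum>t\<le>M. f i (v + t) * of_nat ((v + t) choose v) * fps_nth (\<beta> ^ t) (u - i))"
  unfolding shearY_def
  by (intro sum.cong refl sum.mono_neutral_left) (use assms in \<open>auto simp: power_coeff_low\<close>)

lemma shearY_0: "shearY 0 f = f"
proof (intro ext)
  fix u v
  have "shearY 0 f u v = (\<Sum>i\<le>u. \<Sum>t\<le>u. if t = 0 then if i = u then f u v else 0 else 0)"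
    unfolding shearY_def by (intro sum.cong refl) (auto simp: power_0_left)
  then show "shearY 0 f u v = f u v" by simp
qed

lemma shearY_mulX:
  assumes "fps_nth \<beta> 0 = 0"
  shows "shearY \<beta> (mulX N f) = mulX N (shearY \<beta> f)"
proof (intro ext)
  fix u v
  let ?g = "\<lambda>i. \<Sum>t\<le>u. mulX N f i (v + t) * of_nat ((v + t) choose v) * fps_nth (\<beta> ^ t) (u - i)"
  have s: "shearY \<beta> (mulX N f) u v = (\<Sum>i\<le>u. ?g i)" by (simp add: shearY_def)
  show "shearY \<beta> (mulX N f) u v = mulX N (shearY \<beta> f) u v"
  proof (cases "N \<le> u")
    case False
    then show ?thesis unfolding s by (simp add: mulX_def)
  next
    case True
    have "(\<Sum>i\<le>u. ?g i) = (\<Sum>i\<in>{N..u}. ?g i)"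
      by (rule sum.mono_neutral_right) (auto simp: mulX_def)
    also have "\<dots> = (\<Sum>i\<le>u - N. ?g (i + N))"
      by (rule sum.reindex_bij_witness [of _ "\<lambda>i. i + N" "\<lambda>i. i - N"]) (use True in auto)
    also have "\<dots> = shearY \<beta> f (u - N) v"
      unfolding shearY_bound [OF assms, of "u - N" u f v, OF diff_le_self]
      by (intro sum.cong refl) (simp add: mulX_def add.commute)
    finally show ?thesis using s True by (simp add: mulX_def)
  qed
qed

text \<open>
  Both sides are the coefficient at \<open>(u + v, v)\<close> of \<open>f(X, XY + \<beta>)\<close>: on the right, \<open>Y \<mapsto> Y + \<beta>'\<close> is followed by \<open>X(Y + b)\<close>, and
  \<open>X(Y + \<beta>' + b) = XY + \<beta>\<close>. On the left, replacing \<open>Y\<close> by \<open>XY\<close> moves the coefficient at \<open>(u, v)\<close> to \<open>(u + v, v)\<close>.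
\<close>

lemma shearY_chartX:
  assumes b0: "fps_nth \<beta>' 0 = 0" and \<beta>: "\<beta> = fps_X * (fps_const b + \<beta>')"
  shows "shearY \<beta> f u v = shearY \<beta>' (chartX b f) (u + v) v"
proof -
  let ?c = "fps_const b + \<beta>'"
  have inner: "(\<Sum>t\<le>u + v. of_nat (j choose (v + t)) * b ^ (j - (v + t)) * of_nat ((v + t) choose v) * fps_nth (\<beta>' ^ t) m)
      = (if v \<le> j then of_nat (j choose v) * fps_nth (?c ^ (j - v)) m else 0)" if "j \<le> u + v" for j m
  proof (cases "v \<le> j")
    case True
    have "(\<Sum>t\<le>u + v. of_nat (j choose (v + t)) * b ^ (j - (v + t)) * of_nat ((v + t) choose v) * fps_nth (\<beta>' ^ t) m)
       = (\<Sum>t\<le>j - v. of_nat (j choose (v + t)) * b ^ (j - (v + t)) * of_nat ((v + t) choose v) * fps_nth (\<beta>' ^ t) m)"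
      by (rule sum.mono_neutral_right) (use that in \<open>auto simp: binomial_eq_0\<close>)
    also have "\<dots> = (\<Sum>t\<le>j - v. of_nat (j choose v) * (of_nat ((j - v) choose t) * b ^ (j - v - t) * fps_nth (\<beta>' ^ t) m))"
    proof (intro sum.cong refl)
      fix t assume "t \<in> {..j - v}"
      then have "(j choose (v + t)) * ((v + t) choose v) = (j choose v) * ((j - v) choose t)"
        using choose_mult [of v "v + t" j] True by simp
      then have "of_nat (j choose (v + t)) * of_nat ((v + t) choose v) = (of_nat (j choose v) * of_nat ((j - v) choose t) :: 'a)"
        by (metis of_nat_mult)
      then show "of_nat (j choose (v + t)) * b ^ (j - (v + t)) * of_nat ((v + t) choose v) * fps_nth (\<beta>' ^ t) m =
        of_nat (j choose v) * (of_nat ((j - v) choose t) * b ^ (j - v - t) * fps_nth (\<beta>' ^ t) m)"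
        by (simp add: mult_ac)
    qed
    also have "\<dots> = of_nat (j choose v) * fps_nth (?c ^ (j - v)) m"
    proof -
      have "?c ^ (j - v) = (\<Sum>t\<le>j - v. of_nat ((j - v) choose t) * \<beta>' ^ t * fps_const b ^ (j - v - t))"
        by (subst add.commute) (rule binomial_ring)
      also have "fps_nth \<dots> m = (\<Sum>t\<le>j - v. of_nat ((j - v) choose t) * b ^ (j - v - t) * fps_nth (\<beta>' ^ t) m)"
        unfolding fps_sum_nth
        by (intro sum.cong refl) (simp add: fps_of_nat [symmetric] mult.assoc del: fps_of_nat)
      finally show ?thesis by (simp add: sum_distrib_left)
    qed
    finally show ?thesis using True by simp
  qed (auto simp: binomial_eq_0 intro!: sum.neutral)
  have "shearY \<beta>' (chartX b f) (u + v) v =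
     (\<Sum>d\<le>u + v. \<Sum>t\<le>u + v. \<Sum>j\<le>d. f (d - j) j * (of_nat (j choose (v + t)) * b ^ (j - (v + t)) * of_nat ((v + t) choose v) * fps_nth (\<beta>' ^ t) (u + v - d)))"
    unfolding shearY_def chartX_def sum_distrib_right by (simp add: mult.assoc)
  also have "\<dots> = (\<Sum>d\<le>u + v. \<Sum>j\<le>d. f (d - j) j * (\<Sum>t\<le>u + v. of_nat (j choose (v + t)) * b ^ (j - (v + t)) * of_nat ((v + t) choose v) * fps_nth (\<beta>' ^ t) (u + v - d)))"
    unfolding sum_distrib_left by (intro sum.cong refl sum.swap)
  also have "\<dots> = (\<Sum>d\<le>u + v. \<Sum>j\<le>d. f (d - j) j * (if v \<le> j then of_nat (j choose v) * fps_nth (?c ^ (j - v)) (u + v - d) else 0))"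
    by (intro sum.cong refl) (simp add: inner)
  also have "\<dots> = (\<Sum>(d, j)\<in>(SIGMA d:{..u + v}. {..d}). f (d - j) j * (if v \<le> j then of_nat (j choose v) * fps_nth (?c ^ (j - v)) (u + v - d) else 0))"
    by (simp add: sum.Sigma)
  also have "\<dots> = (\<Sum>(d, j)\<in>{(d, j). v \<le> j \<and> j \<le> d \<and> d \<le> u + v}. f (d - j) j * (of_nat (j choose v) * fps_nth (?c ^ (j - v)) (u + v - d)))"
    by (rule sum.mono_neutral_cong_right) (auto split: if_splits)
  also have "\<dots> = (\<Sum>(i, s)\<in>{(i, s). i + s \<le> u}. f i (v + s) * of_nat ((v + s) choose v) * fps_nth (?c ^ s) (u - i - s))"
    by (rule sum.reindex_bij_witness [of _ "\<lambda>(i, s). (i + v + s, v + s)" "\<lambda>(d, j). (d - j, j - v)"]) (auto simp: mult.assoc)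
  also have "\<dots> = (\<Sum>(i, s)\<in>{..u} \<times> {..u}. f i (v + s) * of_nat ((v + s) choose v) * fps_nth (\<beta> ^ s) (u - i))"
  proof (rule sum.mono_neutral_cong_left)
    show "\<forall>x\<in>{..u} \<times> {..u} - {(i, s). i + s \<le> u}. (case x of (i, s) \<Rightarrow> f i (v + s) * of_nat ((v + s) choose v) * fps_nth (\<beta> ^ s) (u - i)) = 0"
      using power_coeff_nonzeroD [of \<beta>] by (fastforce simp: \<beta>)
  qed (auto simp: \<beta> power_mult_distrib fps_X_power_mult_nth)
  also have "\<dots> = shearY \<beta> f u v" by (simp add: shearY_def sum.cartesian_product)
  finally show ?thesis by simp
qed

lemma shearY_ordX_le:
  assumes "shearY \<beta> f i j \<noteq> 0" shows "ordX f \<le> i"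
proof -
  obtain i' t where "i' \<le> i" "f i' t \<noteq> 0"
    using assms unfolding shearY_def by (metis (no_types, lifting) atMost_iff mult_zero_left sum.not_neutral_contains_not_neutral)
  then show ?thesis using ordX_le [of f i' t] by simp
qed

text \<open>
  Modulo \<open>X\<close> the shear is the identity, so it does not affect the coefficient of the lowest power of \<open>X\<close>.
\<close>

lemma shearY_initial_row:
  assumes "fps_nth \<beta> 0 = 0"
  shows "shearY \<beta> f (ordX f) j = f (ordX f) j"
proof -
  let ?p = "ordX f"
  have z: "i < ?p \<Longrightarrow> f i l = 0" for i l using ordX_le [of f i l] by fastforce
  have "shearY \<beta> f ?p j = (\<Sum>i\<le>?p. \<Sum>t\<le>?p. if t = 0 then if i = ?p then f ?p j else 0 else 0)"
    unfolding shearY_def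
  proof (intro sum.cong refl)
    fix i t assume "i \<in> {..?p}"
    then show "f i (j + t) * of_nat ((j + t) choose j) * fps_nth (\<beta> ^ t) (?p - i) = (if t = 0 then if i = ?p then f ?p j else 0 else 0)"
      using z [of i] assms by (cases "i = ?p") (auto simp: power_0_left fps_power_zeroth)
  qed
  then show ?thesis by simp
qed

section \<open>Sequences of transformations\<close>

text \<open>
  \<open>MonX\<close> and \<open>MonY\<close> are the monoidal transformations centered in \<open>(Z, X)\<close> and \<open>(Z, Y)\<close>; \<open>QuadX b\<close> is the
  quadratic transformation in the direction \<open>(1 : b : 0)\<close>, \<open>QuadY\<close> the one in the direction \<open>(0 : 1 : 0)\<close>.
\<close>

datatype 'a move = MonX | MonY | QuadX 'a | QuadY

fun pullback :: "'a::field move \<Rightarrow> (nat \<Rightarrow> nat \<Rightarrow> 'a) \<Rightarrow> nat \<Rightarrow> nat \<Rightarrow> 'a" where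
  "pullback MonX f = f"
| "pullback MonY f = swap f"
| "pullback (QuadX b) f = chartX b f"
| "pullback QuadY f = chartX 0 (swap f)"

text \<open>
  Interchanges the variables exactly for the transformations with exceptional divisor \<open>Y = 0\<close>, so that
  the exceptional variable is always the first one.
\<close>

fun orient :: "'b move \<Rightarrow> (nat \<Rightarrow> nat \<Rightarrow> 'a) \<Rightarrow> nat \<Rightarrow> nat \<Rightarrow> 'a" where
  "orient MonX f = f"
| "orient MonY f = swap f"
| "orient (QuadX b) f = f"
| "orient QuadY f = swap f"

definition acts :: "'a::field move \<Rightarrow> nat \<Rightarrow> (nat \<Rightarrow> nat \<Rightarrow> 'a) \<Rightarrow> (nat \<Rightarrow> nat \<Rightarrow> 'a) \<Rightarrow> bool" where
  [simp]: "acts mv N f f' \<longleftrightarrow> pullback mv f = mulX N (orient mv f')"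

text \<open>
  Either \<open>0\<close> or a monomial times a unit.
\<close>

definition monomial_like :: "(nat \<Rightarrow> nat \<Rightarrow> 'a::zero) \<Rightarrow> bool" where
  "monomial_like f \<longleftrightarrow> (\<forall>i j. f i j = 0) \<or> (\<exists>p q. f p q \<noteq> 0 \<and> (\<forall>i j. f i j \<noteq> 0 \<longrightarrow> p \<le> i \<and> q \<le> j))"

lemma nonzero_mulX [simp]: "nonzero (mulX N f) = nonzero f"
  unfolding nonzero_def mulX_def by (metis add_diff_cancel_right' le_add2)

lemma nonzero_chartX [simp]: "nonzero (chartX b f) = nonzero f"
  unfolding nonzero_def chartX_row_nonzero_iff by (metis add_diff_cancel_right' le_add2)

lemma nonzero_orient [simp]: "nonzero (orient mv f) = nonzero f"
  by (cases mv) simp_all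

lemma nonzero_pullback [simp]: "nonzero (pullback mv f) = nonzero f"
  by (cases mv) simp_all

lemma acts_nonzero_iff: "acts mv N f f' \<Longrightarrow> nonzero f' \<longleftrightarrow> nonzero f"
  by (metis acts_def nonzero_mulX nonzero_orient nonzero_pullback)

lemma acts_strict_order_le:
  assumes "acts mv N f f'" "nonzero f" shows "strict_order f' \<le> strict_order f"
proof (cases mv)
  case MonX then show ?thesis using monomial_factor_invariants(5) assms by fastforce
next
  case MonY
  then have "swap f = mulX N (swap f')" using assms by simp
  from monomial_factor_invariants(5) [OF this] assms show ?thesis by simp
next
  case (QuadX b) then show ?thesis using quadratic_invariants(3) assms by auto
next
  case QuadY then show ?thesis using quadratic_invariants(3) [of 0 "swap f" N "swap f'"] assms by auto
qed

text \<open>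
  Blowing up a point of multiplicity \<open>m\<close> lowers by \<open>m\<close> the intersection number with the coordinate axis whose
  strict transform is met again; the one with the exceptional divisor is exactly \<open>m\<close>, not more than the
  intersection number with the axis that it replaces. Division by a monomial preserves both and lowers the
  order.
\<close>

lemma monomial_move_decreases:
  assumes act: "acts mv N f f'" and nz: "nonzero f" and "N > 0"
    and eq: "strict_order f' = strict_order f" and pos: "strict_order f > 0"
    and mv: "\<And>b. mv = QuadX b \<Longrightarrow> b = 0"
  shows "((width f' + height f', ord2 f'), (width f + height f, ord2 f)) \<in> less_than <*lex*> less_than"
proof (cases mv)
  case MonX
  then show ?thesis using monomial_factor_invariants [of f N f'] act nz \<open>N > 0\<close> by auto
next
  case MonY
  then have "swap f = mulX N (swap f')" using act by simp
  from monomial_factor_invariants [OF this] show ?thesis using nz \<open>N > 0\<close> by simp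
next
  case (QuadX b)
  then have "b = 0" by (rule mv)
  then have "height f' = strict_order f" "width f' + strict_order f \<le> width f"
    using quadratic_invariants(5,7) [of b f N f'] QuadX act nz eq by auto
  then show ?thesis using strict_order_le_height [OF nz] pos by simp
next
  case QuadY
  have "width f' = strict_order f" "height f' + strict_order f \<le> height f"
    using quadratic_invariants(5,7) [of 0 "swap f" N "swap f'"] QuadY act nz eq by auto
  moreover have "strict_order f \<le> width f"
    using strict_order_le_height [of "swap f"] nz by simp
  ultimately show ?thesis using pos by simp
qed

lemma decreasing_nat_eventually_constant:
  fixes g :: "nat \<Rightarrow> nat"
  assumes "\<And>t. g (Suc t) \<le> g t"
  shows "\<forall>\<^sub>F t in sequentially. g (Suc t) = g t"
proof -
  obtain s where s: "\<And>t. g s \<le> g t"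
    using ex_has_least_nat [of "\<lambda>_. True" _ g] by auto
  have anti: "g t \<le> g s" if "s \<le> t" for t
    using that by (induct rule: dec_induct) (auto intro: order_trans assms)
  then have "g (Suc t) = g t" if "s \<le> t" for t
    using assms [of t] anti [OF that] s [of "Suc t"] by linarith
  then show ?thesis unfolding eventually_sequentially by blast
qed

text \<open>
  \<open>\<beta> t\<close> is the branch seen at time \<open>t\<close>: its coefficients are the directions \<open>b\<close> of the quadratic
  transformations from time \<open>t\<close> on, \<open>Q\<close> marking the times at which one takes place.
\<close>

lemma followed_branch_exists:
  fixes b :: "nat \<Rightarrow> 'a::field" and Q :: "nat \<Rightarrow> bool"
  obtains \<beta> :: "nat \<Rightarrow> 'a fps"
  where "\<And>t. fps_nth (\<beta> t) 0 = 0"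
    and "\<And>t. Q t \<Longrightarrow> \<beta> t = fps_X * (fps_const (b t) + \<beta> (Suc t))"
    and "\<And>t. \<not> Q t \<Longrightarrow> \<beta> (Suc t) = \<beta> t"
proof -
  \<comment> \<open>\<open>c t\<close> counts the quadratic transformations before \<open>t\<close>, and \<open>dir m\<close> is the direction of number
    \<open>m\<close>. Should there be only finitely many, later values of \<open>dir\<close> are arbitrary and do no harm.\<close>
  define c where "c t = card {t'. t' < t \<and> Q t'}" for t
  define dir where "dir m = b (THE t. Q t \<and> c t = m)" for m
  define \<beta> where "\<beta> t = Abs_fps (\<lambda>i. if i = 0 then 0 else dir (c t + i - 1))" for t
  have c_Suc: "c (Suc t) = (if Q t then Suc (c t) else c t)" for t
  proof -
    have "{t'. t' < Suc t \<and> Q t'} = (if Q t then insert t {t'. t' < t \<and> Q t'} else {t'. t' < t \<and> Q t'})"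
      by (auto simp: less_Suc_eq)
    then show ?thesis by (simp add: c_def)
  qed
  have c_mono: "c t \<le> c t'" if "t \<le> t'" for t t'
    using that by (induct rule: dec_induct) (auto simp: c_Suc)
  have c_inj: "t = t'" if "Q t" "Q t'" "c t = c t'" for t t'
  proof (rule ccontr)
    assume "t \<noteq> t'"
    then have "Suc t \<le> t' \<or> Suc t' \<le> t" by auto
    then show False
      using that c_mono [of "Suc t" t'] c_mono [of "Suc t'" t] by (auto simp: c_Suc)
  qed
  have dir: "dir (c t) = b t" if "Q t" for t
    unfolding dir_def by (rule arg_cong [of _ _ b], rule the_equality) (use that c_inj in blast)+
  have 1: "\<And>t. fps_nth (\<beta> t) 0 = 0" by (simp add: \<beta>_def)
  have 2: "\<beta> t = fps_X * (fps_const (b t) + \<beta> (Suc t))" if "Q t" for t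
  proof (rule fps_ext)
    fix i
    show "fps_nth (\<beta> t) i = fps_nth (fps_X * (fps_const (b t) + \<beta> (Suc t))) i"
    proof (cases i)
      case (Suc i')
      then show ?thesis using dir [OF that] that by (cases i') (auto simp: \<beta>_def c_Suc)
    qed (simp add: \<beta>_def)
  qed
  have 3: "\<And>t. \<not> Q t \<Longrightarrow> \<beta> (Suc t) = \<beta> t" unfolding \<beta>_def c_Suc by simp
  show thesis using that 1 2 3 by blast
qed

lemma strict_order_0_monomial:
  assumes "nonzero f" "strict_order f = 0" shows "monomial_like f"
proof -
  obtain i j where ij: "i + j = ord2 f" "f i j \<noteq> 0" using ord2_attained [OF assms(1)] by blast
  then have "i = ordX f" "j = ordY f"
    using ordX_le [of f i j] ordY_le [of f i j] ord2_decomp [OF assms(1)] assms(2) by auto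
  then show ?thesis unfolding monomial_like_def using ij ordX_le ordY_le by metis
qed

text \<open>
  Let \<open>h t\<close> be the series at time \<open>t\<close>, sheared along its branch. A monomial \<open>X^i Y^j\<close> of \<open>h t\<close> is carried
  to one of \<open>h (t + 1)\<close> with the same \<open>j\<close>. A quadratic transformation changes \<open>i - p\<close> by \<open>j - m\<close>, a
  monoidal one preserves \<open>i - p\<close> and lowers the order of the series. For \<open>j < m\<close> this would be an infinite
  descent. That \<open>X^p Y^m\<close> occurs is seen in the lowest power of \<open>X\<close>.
\<close>

lemma sheared_limit_monomial:
  fixes a :: "nat \<Rightarrow> nat \<Rightarrow> nat \<Rightarrow> 'a::field"
  assumes act: "\<And>t. acts (mv t) N (a t) (a (Suc t))" and "N > 0"
    and mv: "\<And>t. mv t = MonX \<or> (\<exists>b. mv t = QuadX b)"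
    and nz: "\<And>t. nonzero (a t)"
    and m: "\<And>t. strict_order (a t) = m" "\<And>t. height (a t) = m" and Y: "\<And>t. ordY (a t) = 0"
    and b0: "\<And>t. fps_nth (\<beta> t) 0 = 0"
    and bQ: "\<And>t b. mv t = QuadX b \<Longrightarrow> \<beta> t = fps_X * (fps_const b + \<beta> (Suc t))"
    and bM: "\<And>t. mv t = MonX \<Longrightarrow> \<beta> (Suc t) = \<beta> t"
  shows "monomial_like (shearY (\<beta> 0) (a 0))"
proof -
  let ?h = "\<lambda>t. shearY (\<beta> t) (a t)"
  have no: "\<not> (?h t i j \<noteq> 0 \<and> j < m)" for t i j
  proof (induct x \<equiv> "(i - ordX (a t), ord2 (a t))" arbitrary: t i
      rule: wf_induct_rule [OF wf_lex_prod [OF wf_less_than wf_less_than]])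
    case (1 t i)
    show ?case
    proof
      assume h: "?h t i j \<noteq> 0 \<and> j < m"
      then have pi: "ordX (a t) \<le> i" using shearY_ordX_le by blast
      consider "mv t = MonX" | b where "mv t = QuadX b" using mv by blast
      then show False
      proof cases
        case 1
        then have e: "a t = mulX N (a (Suc t))" using act [of t] by simp
        have "?h t = mulX N (?h (Suc t))"
          using shearY_mulX [OF b0, of t N "a (Suc t)"] e bM [OF 1] by simp
        note D = mulX_eqD [OF this]
        have "N \<le> i" "?h (Suc t) (i - N) j \<noteq> 0" using h D by auto
        then show False
          using "1.hyps" [of "i - N" "Suc t"] h monomial_factor_invariants(2,4) [OF e nz] \<open>N > 0\<close>
          by (simp add: add.commute)
      next
        case (2 b)
        then have e: "chartX b (a t) = mulX N (a (Suc t))" using act [of t] by simp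
        have s: "?h t i j = mulX N (?h (Suc t)) (i + j) j"
          using shearY_chartX [OF b0 bQ [OF 2], of "a t" i j] shearY_mulX [OF b0, of "Suc t" N "a (Suc t)"] e
          by simp
        then have n: "N \<le> i + j" "?h (Suc t) (i + j - N) j \<noteq> 0" using h by (auto simp: mulX_def split: if_splits)
        have "ordX (a (Suc t)) \<le> i + j - N" using n shearY_ordX_le by blast
        moreover have "ordX (a (Suc t)) + N = ordX (a t) + m"
          using quadratic_invariants(2) [OF e nz] ord2_decomp [OF nz, of t] m Y by simp
        ultimately have "i + j - N - ordX (a (Suc t)) < i - ordX (a t)" using n h pi by linarith
        then show False using "1.hyps" [of "i + j - N" "Suc t"] n h by auto
      qed
    qed
  qed
  let ?p = "ordX (a 0)"
  have "?h 0 ?p m \<noteq> 0"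
    using height_attained [OF nz, of 0] m Y by (simp add: shearY_initial_row [OF b0])
  moreover have "?p \<le> i \<and> m \<le> j" if "?h 0 i j \<noteq> 0" for i j
    using that no [of 0 i j] shearY_ordX_le by force
  ultimately show ?thesis unfolding monomial_like_def by blast
qed

text \<open>
  The indices with \<open>a k = 0\<close> are harmless and left aside; \<open>L\<close> is the set of the others. The shear has to be the same
  for all of them, which holds because the transformations, hence the branch, do not depend on \<open>k\<close>.
\<close>

theorem moves_reach_monomials:
  fixes a :: "nat \<Rightarrow> nat \<Rightarrow> nat \<Rightarrow> nat \<Rightarrow> 'a::field"
  assumes fin: "finite K" and N: "\<And>k. k \<in> K \<Longrightarrow> N k > 0"
    and act: "\<And>k t. k \<in> K \<Longrightarrow> acts (mv t) (N k) (a k t) (a k (Suc t))"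
  shows "\<exists>r \<beta>. fps_nth \<beta> 0 = 0 \<and> (\<forall>k\<in>K. monomial_like (shearY \<beta> (a k r)))"
proof -
  define L where "L = {k \<in> K. nonzero (a k 0)}"
  have LK: "k \<in> K" if "k \<in> L" for k using that by (simp add: L_def)
  have nz_iff: "nonzero (a k t) \<longleftrightarrow> nonzero (a k 0)" if "k \<in> K" for k t
    by (induct t) (use acts_nonzero_iff [OF act [OF that]] in auto)
  have nz: "nonzero (a k t)" if "k \<in> L" for k t using that nz_iff by (simp add: L_def)
  have zero: "monomial_like (shearY \<beta> (a k t))" if "k \<in> K - L" for k t and \<beta> :: "'a fps"
    using that nz_iff [of k t] by (simp add: L_def nonzero_def monomial_like_def shearY_def)
  have "\<forall>\<^sub>F t in sequentially. \<forall>k\<in>L. strict_order (a k (Suc t)) = strict_order (a k t)"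
  proof (rule eventually_ball_finite)
    show "finite L" using fin by (simp add: L_def)
    show "\<forall>k\<in>L. \<forall>\<^sub>F t in sequentially. strict_order (a k (Suc t)) = strict_order (a k t)"
      using acts_strict_order_le [OF act nz] LK by (intro ballI decreasing_nat_eventually_constant) blast
  qed
  then obtain s0 where s0: "\<And>t k. s0 \<le> t \<Longrightarrow> k \<in> L \<Longrightarrow> strict_order (a k (Suc t)) = strict_order (a k t)"
    unfolding eventually_sequentially by blast
  define m where "m k = strict_order (a k s0)" for k
  have m: "strict_order (a k t) = m k" if "s0 \<le> t" "k \<in> L" for k t
    using that(1) by (induct rule: dec_induct) (use that(2) s0 in \<open>auto simp: m_def\<close>)
  show ?thesis
  proof (cases "\<forall>k\<in>L. m k = 0")
    case True
    have "monomial_like (shearY 0 (a k s0))" if "k \<in> K" for k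
    proof (cases "k \<in> L")
      case l: True
      then show ?thesis using strict_order_0_monomial [OF nz [OF l]] True by (simp add: m_def shearY_0)
    qed (use zero that in blast)
    then show ?thesis by (intro exI [of _ s0] exI [of _ 0]) simp
  next
    case False
    then obtain k0 where k0: "k0 \<in> L" "m k0 > 0" by auto
    \<comment> \<open>Otherwise only coordinate axes are followed, and the intersection numbers of a strict part of
      positive order with them, or else the order of the series, would decrease for ever.\<close>
    have "\<exists>s\<ge>s0. \<exists>b. b \<noteq> 0 \<and> mv s = QuadX b"
    proof (rule ccontr)
      assume no: "\<not> ?thesis"
      let ?x = "\<lambda>t. (width (a k0 (s0 + t)) + height (a k0 (s0 + t)), ord2 (a k0 (s0 + t)))"
      have "(?x (Suc t), ?x t) \<in> less_than <*lex*> less_than" for t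
        unfolding add_Suc_right
      proof (rule monomial_move_decreases [OF act [OF LK [OF k0(1)]] nz [OF k0(1)] N [OF LK [OF k0(1)]]])
        show "strict_order (a k0 (Suc (s0 + t))) = strict_order (a k0 (s0 + t))"
          using s0 k0(1) by simp
        show "0 < strict_order (a k0 (s0 + t))" using m [of "s0 + t" k0] k0 by simp
        show "b = 0" if "mv (s0 + t) = QuadX b" for b using no that le_add1 by blast
      qed
      then have "\<exists>x. \<forall>t. (x (Suc t), x t) \<in> less_than <*lex*> less_than"
        by (intro exI [of _ ?x] allI)
      then have "\<not> wf (less_than <*lex*> less_than)"
        unfolding wf_iff_no_infinite_down_chain by simp
      then show False using wf_lex_prod [OF wf_less_than wf_less_than] by (rule notE)
    qed
    then obtain s b where s: "s0 \<le> s" "b \<noteq> 0" "mv s = QuadX b" by blast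
    have eqs: "strict_order (a k (Suc t)) = strict_order (a k t)" if "s \<le> t" "k \<in> L" for k t
      using s0 that s(1) by simp
    have quad: "ordY (a k (Suc t)) = 0 \<and> height (a k (Suc t)) = m k"
      if "s \<le> t" "k \<in> L" "mv t = QuadX c" "c \<noteq> 0 \<or> ordY (a k t) = 0" for k t c
    proof -
      have "chartX c (a k t) = mulX (N k) (a k (Suc t))" using act [OF LK [OF that(2)], of t] that by simp
      from quadratic_invariants(4,5,6) [OF this nz [OF that(2)]] eqs [OF that(1,2)] that m [of t k] s(1)
      show ?thesis by auto
    qed
    have X: "mv t = MonX \<or> (\<exists>b. mv t = QuadX b)"
      if "s \<le> t" "ordY (a k0 t) = 0 \<and> height (a k0 t) = m k0" for t
    proof (cases "mv t")
      case MonY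
      then have "swap (a k0 t) = mulX (N k0) (swap (a k0 (Suc t)))"
        using act [OF LK [OF k0(1)], of t] by simp
      \<comment> \<open>The factor \<open>Y^N\<close> to be divided off is not there.\<close>
      from monomial_factor_invariants(2) [OF this] nz [OF k0(1)] have "ordY (a k0 t) \<ge> N k0" by simp
      then show ?thesis using that N [OF LK [OF k0(1)]] by simp
    next
      case QuadY
      then have "chartX 0 (swap (a k0 t)) = mulX (N k0) (swap (a k0 (Suc t)))"
        using act [OF LK [OF k0(1)], of t] by simp
      \<comment> \<open>The intersection number with \<open>X = 0\<close>, equal to \<open>m\<close>, would drop to \<open>0\<close>,
        although the strict part keeps the order \<open>m > 0\<close>.\<close>
      from quadratic_invariants(7) [OF this] nz [OF k0(1)] eqs [OF that(1) k0(1)]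
      have "height (a k0 (Suc t)) + m k0 \<le> height (a k0 t)"
        using m [of t k0] that(1) s(1) k0 by simp
      moreover have "m k0 \<le> height (a k0 (Suc t))"
        using strict_order_le_height [OF nz [OF k0(1)], of "Suc t"] m [of "Suc t" k0] that(1) s(1) k0 by simp
      ultimately show ?thesis using that k0 by simp
    qed auto
    have inv: "\<forall>k\<in>L. ordY (a k t) = 0 \<and> height (a k t) = m k" if "Suc s \<le> t" for t
      using that
    proof (induct rule: dec_induct)
      case base
      show ?case using quad [of s _ b] s by auto
    next
      case (step t)
      then have st: "s \<le> t" by simp
      consider "mv t = MonX" | c where "mv t = QuadX c" using X [OF st] step(3) k0 by blast
      then show ?case
      proof cases
        case 1
        show ?thesis
        proof
          fix k assume k: "k \<in> L"
          have "a k t = mulX (N k) (a k (Suc t))" using act [OF LK [OF k], of t] 1 by simp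
          from monomial_factor_invariants(3,7) [OF this nz [OF k]] step(3) k
          show "ordY (a k (Suc t)) = 0 \<and> height (a k (Suc t)) = m k" by simp
        qed
      next
        case 2
        then show ?thesis using quad [OF st] step(3) by blast
      qed
    qed
    have mvX: "mv t = MonX \<or> (\<exists>b. mv t = QuadX b)" if "Suc s \<le> t" for t
      using X inv that k0 by simp
    let ?r = "Suc s"
    obtain \<beta> :: "nat \<Rightarrow> 'a fps" where \<beta>: "\<And>t. fps_nth (\<beta> t) 0 = 0"
      "\<And>t. \<exists>b. mv (?r + t) = QuadX b \<Longrightarrow> \<beta> t = fps_X * (fps_const (case mv (?r + t) of QuadX b \<Rightarrow> b | _ \<Rightarrow> 0) + \<beta> (Suc t))"
      "\<And>t. \<nexists>b. mv (?r + t) = QuadX b \<Longrightarrow> \<beta> (Suc t) = \<beta> t"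
      by (rule followed_branch_exists
          [of "\<lambda>t. \<exists>b. mv (?r + t) = QuadX b" "\<lambda>t. case mv (?r + t) of QuadX b \<Rightarrow> b | _ \<Rightarrow> 0"]) blast
    have "monomial_like (shearY (\<beta> 0) (a k ?r))" if "k \<in> K" for k
    proof (cases "k \<in> L")
      case l: True
      have "monomial_like (shearY (\<beta> 0) (a k (?r + 0)))"
      proof (rule sheared_limit_monomial [where N = "N k" and m = "m k" and mv = "\<lambda>t. mv (?r + t)"])
        show "acts (mv (?r + t)) (N k) (a k (?r + t)) (a k (?r + Suc t))" for t
          using act [OF that, of "?r + t"] by simp
        show "\<beta> t = fps_X * (fps_const b + \<beta> (Suc t))" if "mv (?r + t) = QuadX b" for t b
          using \<beta>(2) [of t] that by auto
        show "strict_order (a k (?r + t)) = m k" for t using m [of "?r + t" k] s(1) l by simp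
        show "mv (?r + t) = MonX \<or> (\<exists>b. mv (?r + t) = QuadX b)" for t by (rule mvX) simp
        show "height (a k (?r + t)) = m k" "ordY (a k (?r + t)) = 0" for t using inv [of "?r + t"] l by auto
      qed (use \<beta> nz l N that in auto)
      then show ?thesis by simp
    qed (use zero that in blast)
    then show ?thesis using \<beta>(1) by blast
  qed
qed

section \<open>Substitution on coefficients\<close>

definition slice :: "'a::zero fps fps fps \<Rightarrow> nat \<Rightarrow> nat \<Rightarrow> nat \<Rightarrow> 'a" where
  "slice F k i j = coeff3 F i j k"

lemma linear_power_nth:
  fixes c :: "'b::comm_ring_1"
  shows "fps_nth ((fps_X + fps_const c) ^ k) w = of_nat (k choose w) * c ^ (k - w)"
proof -
  have "fps_nth ((fps_X + fps_const c) ^ k) w = (\<Sum>i\<le>k. if i = w then of_nat (k choose w) * c ^ (k - w) else 0)"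
    unfolding binomial_ring fps_sum_nth
    by (intro sum.cong refl) (auto simp: fps_of_nat [symmetric] mult.assoc fps_X_power_iff simp del: fps_of_nat)
  then show ?thesis by (auto simp: binomial_eq_0)
qed

text \<open>
  In all four charts the image of a monomial is of the form on the left, see \<open>chart_monomials\<close>; this is why
  one coefficient computation serves them all.
\<close>

lemma coeff3_chart_monomial:
  "coeff3 (varX ^ e * (varY + const3 b) ^ m * (varZ + const3 c) ^ k) u v w =
     (if u = e then of_nat (m choose v) * b ^ (m - v) * (of_nat (k choose w) * c ^ (k - w)) else 0)"
proof -
  let ?M = "fps_const (fps_X ^ e) * (fps_X + fps_const (fps_const b)) ^ m"
  have 1: "varX ^ e * (varY + const3 b) ^ m = fps_const ?M"
    by (simp add: varX_def varY_def const3_def)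
  have 2: "fps_nth ((varZ + const3 c) ^ k) w = fps_const (fps_const (of_nat (k choose w) * c ^ (k - w)))"
    unfolding varZ_def const3_def linear_power_nth
    by (simp add: fps_of_nat [symmetric] del: fps_of_nat)
  have 3: "fps_nth ((fps_X + fps_const (fps_const b)) ^ m) v = fps_const (of_nat (m choose v) * b ^ (m - v))"
    unfolding linear_power_nth by (simp add: fps_of_nat [symmetric] del: fps_of_nat)
  show ?thesis unfolding coeff3_def 1
    by (simp add: 2 3 mult.assoc del: fps_const_mult) (simp add: fps_X_power_iff)
qed

lemma coeff3_subst3:
  "coeff3 (subst3 P Q R F) u v w =
     (\<Sum>(i, j, k) \<in> {(i, j, k). i + j + k \<le> u + v + w}. coeff3 F i j k * coeff3 (P ^ i * Q ^ j * R ^ k) u v w)"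
  by (simp add: subst3_def series3_def coeff3_def)

lemma finite_triples: "finite {(i, j, k). i + j + k \<le> (M::nat)}"
  by (rule finite_subset [of _ "{..M} \<times> {..M} \<times> {..M}"]) auto

lemma finite_pairs: "finite {(i, j). i + j \<le> (M::nat)}"
  by (rule finite_subset [of _ "{..M} \<times> {..M}"]) auto

lemma triple_sum_slice:
  fixes g :: "nat \<Rightarrow> nat \<Rightarrow> nat \<Rightarrow> 'b::comm_monoid_add"
  assumes "\<And>i j k. k \<noteq> w \<Longrightarrow> g i j k = 0"
  shows "(\<Sum>(i, j, k) \<in> {(i, j, k). i + j + k \<le> M + w}. g i j k) = (\<Sum>(i, j) \<in> {(i, j). i + j \<le> M}. g i j w)"
proof -
  have nz: "k = w" if "g i j k \<noteq> 0" for i j k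
    using assms that by blast
  have "(\<Sum>(i, j, k) \<in> {(i, j, k). i + j + k \<le> M + w}. g i j k) =
    (\<Sum>(i, j, k) \<in> {(i, j, k). i + j \<le> M \<and> k = w}. g i j k)"
    by (rule sum.mono_neutral_right [OF finite_triples]) (auto dest: nz)
  also have "\<dots> = (\<Sum>(i, j) \<in> {(i, j). i + j \<le> M}. g i j w)"
    by (rule sum.reindex_bij_witness [of _ "\<lambda>(i, j). (i, j, w)" "\<lambda>(i, j, k). (i, j)"]) auto
  finally show ?thesis .
qed

lemma choose_nonzeroD: "of_nat (m choose v) \<noteq> (0::'b::semiring_1) \<Longrightarrow> v \<le> m"
  by (metis binomial_eq_0 linorder_not_le of_nat_0)

lemma slice_transvection:
  assumes b0: "fps_nth \<beta> 0 = 0"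
  shows "slice (subst3 varX (varY + fps_const (fps_const \<beta>)) varZ F) w = shearY \<beta> (slice F w)"
proof (intro ext)
  fix u v
  have mon: "coeff3 (varX ^ i * (varY + fps_const (fps_const \<beta>)) ^ j * varZ ^ k) u v w =
    (if k = w then if i \<le> u then of_nat (j choose v) * fps_nth (\<beta> ^ (j - v)) (u - i) else 0 else 0)" for i j k
  proof -
    have "varX ^ i * (varY + fps_const (fps_const \<beta>)) ^ j
        = fps_const (fps_const (fps_X ^ i) * (fps_X + fps_const \<beta>) ^ j)"
      by (simp add: varX_def varY_def)
    moreover have "fps_nth (fps_const G * varZ ^ k) w = (if k = w then G else 0)" for G :: "'a fps fps"
      by (auto simp: varZ_def fps_X_power_iff)
    moreover have "fps_nth ((fps_X + fps_const \<beta>) ^ j) v = fps_const (of_nat (j choose v)) * \<beta> ^ (j - v)"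
      by (simp add: linear_power_nth fps_of_nat)
    ultimately show ?thesis
      by (simp add: coeff3_def fps_X_power_mult_nth)
  qed
  have "slice (subst3 varX (varY + fps_const (fps_const \<beta>)) varZ F) w u v =
     (\<Sum>(i, j) \<in> {(i, j). i + j \<le> u + v}.
        slice F w i j * (if i \<le> u then of_nat (j choose v) * fps_nth (\<beta> ^ (j - v)) (u - i) else 0))"
    unfolding slice_def coeff3_subst3 mon by (subst triple_sum_slice) auto
  also have "\<dots> = (\<Sum>(i, j) \<in> {(i, j). v \<le> j \<and> i + (j - v) \<le> u}.
        slice F w i j * (of_nat (j choose v) * fps_nth (\<beta> ^ (j - v)) (u - i)))"
    by (rule sum.mono_neutral_cong_right [OF finite_pairs]) (auto dest: choose_nonzeroD split: if_splits)
  also have "\<dots> = (\<Sum>(i, t) \<in> {(i, t). i + t \<le> u}. slice F w i (v + t) * of_nat ((v + t) choose v) * fps_nth (\<beta> ^ t) (u - i))"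
    by (rule sum.reindex_bij_witness [of _ "\<lambda>(i, t). (i, v + t)" "\<lambda>(i, j). (i, j - v)"]) (auto simp: mult.assoc)
  also have "\<dots> = (\<Sum>(i, t) \<in> {..u} \<times> {..u}. slice F w i (v + t) * of_nat ((v + t) choose v) * fps_nth (\<beta> ^ t) (u - i))"
    by (rule sum.mono_neutral_left) (auto dest: power_coeff_nonzeroD [OF _ b0])
  also have "\<dots> = shearY \<beta> (slice F w) u v" by (simp add: shearY_def sum.cartesian_product)
  finally show "slice (subst3 varX (varY + fps_const (fps_const \<beta>)) varZ F) w u v = shearY \<beta> (slice F w) u v" .
qed

section \<open>The algorithm on coefficients\<close>

text \<open>
  The shape \<open>Z^n + \<Sum> a\<^sub>k Z^k\<close> with \<open>k \<le> n - 2\<close>; unlike \<open>WT_equation\<close> it says nothing about the orders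
  of the \<open>a\<^sub>k\<close>, which is what makes it easy to propagate.
\<close>

definition depressed_monic :: "nat \<Rightarrow> 'a::field fps fps fps \<Rightarrow> bool" where
  "depressed_monic n F \<longleftrightarrow>
     slice F n = (\<lambda>i j. if i = 0 \<and> j = 0 then 1 else 0) \<and>
     \<not> nonzero (slice F (n - 1)) \<and> (\<forall>k>n. \<not> nonzero (slice F k))"

lemma WT_depressed_monic:
  assumes "n > 1" "WT_equation n F" shows "depressed_monic n F"
proof -
  obtain a where "F = varZ ^ n + (\<Sum>k = 0..n - 2. fps_const (a k) * varZ ^ k)"
    using assms by (auto simp: WT_equation_def)
  then have F: "fps_nth F m = (if m = n then 1 else 0) + (\<Sum>k = 0..n - 2. if k = m then a k else 0)" for m
    by (auto simp: varZ_def fps_sum_nth fps_X_power_iff if_distrib intro!: sum.cong cong: if_cong)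
  have "fps_nth F n = 1" "fps_nth F (n - 1) = 0" "\<And>m. m > n \<Longrightarrow> fps_nth F m = 0"
    using assms(1) by (auto simp: F)
  then show ?thesis
    by (auto simp: depressed_monic_def slice_def coeff3_def nonzero_def fun_eq_iff)
qed

lemma coeff3_below_order:
  assumes "nu3 F = enat n" "i + j + k < n" shows "coeff3 F i j k = 0"
proof (rule ccontr)
  assume "coeff3 F i j k \<noteq> 0"
  then have "nu3 F \<le> enat (i + j + k)" unfolding nu3_def by (intro Inf_lower) blast
  then show False using assms by simp
qed

text \<open>
  \<open>Z^n\<close> is mapped to \<open>E^n (Z + c)^n\<close> with \<open>E\<close> the exceptional variable, which contributes \<open>n c\<close>
  to the coefficient of \<open>E^n Z^(n-1)\<close>; no other monomial of \<open>F\<close> involves a power of \<open>Z\<close> large enough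
  to contribute.
\<close>

lemma next_to_top_coeff:
  assumes dm: "depressed_monic n F" and "n > 1"
    and mon: "\<And>i j k. P ^ i * Q ^ j * R ^ k = varX ^ e i j k * (varY + const3 b) ^ m i j k * (varZ + const3 c) ^ k"
    and u: "u = e 0 0 n" and v: "v = m 0 0 n" and "0 < u + v"
  shows "coeff3 (subst3 P Q R F) u v (n - 1) = of_nat n * c"
proof -
  have "coeff3 F i j k * coeff3 (P ^ i * Q ^ j * R ^ k) u v (n - 1) =
     (if (i, j, k) = (0, 0, n) then of_nat n * c else 0)" for i j k
  proof -
    consider "k < n - 1" | "k = n - 1" | "k = n" | "k > n" by linarith
    then show ?thesis
    proof cases
      case 1 then show ?thesis by (auto simp: mon coeff3_chart_monomial binomial_eq_0)
    next
      case 2 then show ?thesis using dm \<open>n > 1\<close> by (auto simp: depressed_monic_def slice_def nonzero_def)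
    next
      case 3
      have "coeff3 F i j n = (if i = 0 \<and> j = 0 then 1 else 0)"
        using dm by (simp add: depressed_monic_def slice_def fun_eq_iff)
      moreover have "n choose (n - 1) = n" using \<open>n > 1\<close> binomial_symmetric [of 1 n] by simp
      ultimately show ?thesis using 3 \<open>n > 1\<close> by (simp add: mon coeff3_chart_monomial u v)
    next
      case 4 then show ?thesis using dm by (auto simp: depressed_monic_def slice_def nonzero_def)
    qed
  qed
  then have "coeff3 (subst3 P Q R F) u v (n - 1) =
      (\<Sum>x \<in> {(i, j, k). i + j + k \<le> u + v + (n - 1)}. if x = (0, 0, n) then of_nat n * c else 0)"
    unfolding coeff3_subst3 by (intro sum.cong refl) (auto split: if_splits)
  also have "\<dots> = of_nat n * c"
  proof -
    have "n \<le> u + v + (n - 1)" using \<open>0 < u + v\<close> by linarith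
    then show ?thesis by (simp add: sum.delta finite_triples del: One_nat_def)
  qed
  finally show ?thesis .
qed

text \<open>
  For \<open>c = 0\<close> the charts multiply \<open>Z\<close> by the exceptional variable only, so they act on each coefficient of a
  power of \<open>Z\<close> separately.
\<close>

lemma slice_chart:
  assumes mon: "\<And>i j k. P ^ i * Q ^ j * R ^ k = varX ^ e i j k * (varY + const3 b) ^ m i j k * (varZ + const3 0) ^ k"
  shows "slice (subst3 P Q R F) w u v =
    (\<Sum>(i, j) \<in> {(i, j). i + j \<le> u + v}.
       slice F w i j * (if u = e i j w then of_nat (m i j w choose v) * b ^ (m i j w - v) else 0))"
proof -
  have mon': "coeff3 (P ^ i * Q ^ j * R ^ k) u v w =
     (if k = w then if u = e i j k then of_nat (m i j k choose v) * b ^ (m i j k - v) else 0 else 0)" for i j k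
    using coeff3_chart_monomial [of "e i j k" b "m i j k" 0 k u v w]
    by (auto simp: mon power_0_left binomial_eq_0)
  show ?thesis
    unfolding slice_def coeff3_subst3 mon' by (subst triple_sum_slice) auto
qed

lemma antidiagonal_sum:
  fixes g :: "nat \<Rightarrow> nat \<Rightarrow> 'b::comm_monoid_add"
  shows "(\<Sum>(i, j) \<in> {(i, j). i + j = d}. g i j) = (\<Sum>j\<le>d. g (d - j) j)"
  by (rule sum.reindex_bij_witness [of _ "\<lambda>j. (d - j, j)" snd]) auto

lemma single_term_sum:
  fixes g :: "nat \<times> nat \<Rightarrow> 'b::comm_monoid_add"
  assumes "\<And>x. x \<in> {(i, j). i + j \<le> M} \<Longrightarrow> x \<noteq> z \<Longrightarrow> g x = 0"
  shows "sum g {(i, j). i + j \<le> M} = (if fst z + snd z \<le> M then g z else 0)"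
proof -
  have "sum g {(i, j). i + j \<le> M} = (\<Sum>x \<in> {(i, j). i + j \<le> M}. if x = z then g z else 0)"
    using assms by (intro sum.cong refl) auto
  then show ?thesis by (cases z) (simp add: sum.delta finite_pairs)
qed

lemma choose_zero_power: "of_nat (m choose v) * (0::'a::field) ^ (m - v) = (if m = v then 1 else 0)"
  by (auto simp: power_0_left binomial_eq_0)

fun chart_subst :: "'a::field move \<Rightarrow> 'a \<Rightarrow> 'a fps fps fps \<Rightarrow> 'a fps fps fps" where
  "chart_subst MonX c = subst3 varX varY (varX * (varZ + const3 c))"
| "chart_subst MonY c = subst3 varX varY (varY * (varZ + const3 c))"
| "chart_subst (QuadX b) c = subst3 varX (varX * (varY + const3 b)) (varX * (varZ + const3 c))"
| "chart_subst QuadY c = subst3 (varX * varY) varY (varY * (varZ + const3 c))"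

fun exceptional :: "'a::field move \<Rightarrow> 'a fps fps fps" where
  "exceptional MonX = varX"
| "exceptional MonY = varY"
| "exceptional (QuadX b) = varX"
| "exceptional QuadY = varY"

lemma const3_0: "const3 0 = 0"
  by (simp add: const3_def)

lemma chart_monomials:
  fixes b c :: "'a::field"
  shows "varX ^ i * varY ^ j * (varX * (varZ + const3 c)) ^ k =
      varX ^ (i + k) * (varY + const3 0) ^ j * (varZ + const3 c) ^ k"
    "varX ^ i * varY ^ j * (varY * (varZ + const3 c)) ^ k =
      varX ^ i * (varY + const3 0) ^ (j + k) * (varZ + const3 c) ^ k"
    "varX ^ i * (varX * (varY + const3 b)) ^ j * (varX * (varZ + const3 c)) ^ k =
      varX ^ (i + j + k) * (varY + const3 b) ^ j * (varZ + const3 c) ^ k"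
    "(varX * varY) ^ i * varY ^ j * (varY * (varZ + const3 c)) ^ k =
      varX ^ i * (varY + const3 0) ^ (i + j + k) * (varZ + const3 c) ^ k"
  by (simp_all add: const3_0 power_mult_distrib power_add mult_ac)

lemma slice_chart_subst:
  "orient mv (slice (chart_subst mv 0 F) w) = mulX w (pullback mv (slice F w))"
proof (intro ext)
  fix u v
  show "orient mv (slice (chart_subst mv 0 F) w) u v = mulX w (pullback mv (slice F w)) u v"
  proof (cases mv)
    case MonX
    have "slice (chart_subst mv 0 F) w u v =
       (\<Sum>(i, j) \<in> {(i, j). i + j \<le> u + v}. slice F w i j * (if u = i + w then if j = v then 1 else 0 else 0))"
      unfolding MonX chart_subst.simps
      by (subst slice_chart [OF chart_monomials(1)], intro sum.cong refl) (auto simp: choose_zero_power)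
    also have "\<dots> = mulX w (slice F w) u v"
      by (subst single_term_sum [of _ "(u - w, v)"]) (auto simp: mulX_def split: if_splits)
    finally show ?thesis using MonX by simp
  next
    case MonY
    have "slice (chart_subst mv 0 F) w v u =
       (\<Sum>(i, j) \<in> {(i, j). i + j \<le> v + u}. slice F w i j * (if v = i then if j + w = u then 1 else 0 else 0))"
      unfolding MonY chart_subst.simps
      by (subst slice_chart [OF chart_monomials(2)], intro sum.cong refl) (auto simp: choose_zero_power)
    also have "\<dots> = mulX w (swap (slice F w)) u v"
      by (subst single_term_sum [of _ "(v, u - w)"]) (auto simp: mulX_def swap_def split: if_splits)
    finally show ?thesis using MonY by (simp add: swap_def)
  next
    case (QuadX b)
    have "slice (chart_subst mv 0 F) w u v =
       (\<Sum>(i, j) \<in> {(i, j). i + j \<le> u + v}. slice F w i j * (if u = i + j + w then of_nat (j choose v) * b ^ (j - v) else 0))"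
      unfolding QuadX chart_subst.simps
      by (rule slice_chart [OF chart_monomials(3)])
    also have "\<dots> = mulX w (chartX b (slice F w)) u v"
    proof (cases "w \<le> u")
      case True
      have "(\<Sum>(i, j) \<in> {(i, j). i + j \<le> u + v}. slice F w i j * (if u = i + j + w then of_nat (j choose v) * b ^ (j - v) else 0))
        = (\<Sum>(i, j) \<in> {(i, j). i + j = u - w}. slice F w i j * (of_nat (j choose v) * b ^ (j - v)))"
        by (rule sum.mono_neutral_cong_right [OF finite_pairs]) (use True in \<open>auto split: if_splits\<close>)
      also have "\<dots> = (\<Sum>j\<le>u - w. slice F w (u - w - j) j * (of_nat (j choose v) * b ^ (j - v)))"
        by (rule antidiagonal_sum)
      finally show ?thesis using True by (simp add: mulX_def chartX_def mult.assoc)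
    next
      case False
      then show ?thesis by (auto simp: mulX_def intro!: sum.neutral)
    qed
    finally show ?thesis using QuadX by simp
  next
    case QuadY
    have "slice (chart_subst mv 0 F) w v u =
       (\<Sum>(i, j) \<in> {(i, j). i + j \<le> v + u}. slice F w i j * (if v = i then if i + j + w = u then 1 else 0 else 0))"
      unfolding QuadY chart_subst.simps
      by (subst slice_chart [OF chart_monomials(4)], intro sum.cong refl) (auto simp: choose_zero_power)
    also have "\<dots> = mulX w (chartX 0 (swap (slice F w))) u v"
      by (subst single_term_sum [of _ "(v, u - w - v)"]) (auto simp: mulX_def chartX_0 swap_def split: if_splits)
    finally show ?thesis using QuadY by (simp add: swap_def)
  qed
qed

lemma slice_exceptional_power:
  "orient mv (slice (exceptional mv ^ n * F) w) = mulX n (orient mv (slice F w))"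
proof -
  have X: "slice (varX ^ n * F) w = mulX n (slice F w)"
    by (intro ext) (simp add: slice_def coeff3_def varX_def mulX_def fps_X_power_mult_nth)
  have Y: "swap (slice (varY ^ n * F) w) = mulX n (swap (slice F w))"
    by (intro ext) (simp add: slice_def coeff3_def varY_def mulX_def swap_def fps_X_power_mult_nth)
  show ?thesis using X Y by (cases mv) simp_all
qed

lemma algorithm_step_chart:
  assumes "algorithm_step F F'"
  obtains mv c where "exceptional mv ^ mult3 F * F' = chart_subst mv c F"
proof -
  have "\<exists>mv c. exceptional mv ^ mult3 F * F' = chart_subst mv c F"
    using assms
    unfolding algorithm_step_def quadratic_transform_def monoidal_transform_ZX_def monoidal_transform_ZY_def
    by (metis chart_subst.simps exceptional.simps)
  then show thesis using that by blast
qed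

lemma direction_Z_zero:
  fixes F F' :: "'a::field_char_0 fps fps fps"
  assumes "n > 1" "depressed_monic n F" "nu3 F' = enat n"
    and e: "exceptional mv ^ n * F' = chart_subst mv c F"
  shows "c = 0"
proof -
  have 0: "slice F' (n - 1) 0 0 = 0"
    using coeff3_below_order [OF assms(3)] assms(1) by (simp add: slice_def)
  have "of_nat n * c = orient mv (slice (chart_subst mv c F) (n - 1)) n 0"
  proof (cases mv)
    case MonX
    then show ?thesis
      using next_to_top_coeff [OF assms(2,1) chart_monomials(1) [of _ _ c], of n 0] assms(1) by (simp add: slice_def)
  next
    case MonY
    then show ?thesis
      using next_to_top_coeff [OF assms(2,1) chart_monomials(2) [of _ _ c], of 0 n] assms(1) by (simp add: slice_def swap_def)
  next
    case (QuadX b)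
    then show ?thesis
      using next_to_top_coeff [OF assms(2,1) chart_monomials(3) [of _ b _ c], of n 0] assms(1) by (simp add: slice_def)
  next
    case QuadY
    then show ?thesis
      using next_to_top_coeff [OF assms(2,1) chart_monomials(4) [of _ _ c], of 0 n] assms(1) by (simp add: slice_def swap_def)
  qed
  also have "\<dots> = orient mv (slice F' (n - 1)) 0 0"
    unfolding e [symmetric] slice_exceptional_power by (simp add: mulX_def)
  also have "\<dots> = 0" using 0 by (cases mv) (simp_all add: swap_def)
  finally show ?thesis using assms(1) by simp
qed

text \<open>
  The factor \<open>E^k\<close> coming from \<open>Z^k \<mapsto> E^k Z^k\<close> cancels against the division by \<open>E^n\<close>, where \<open>E\<close> is the exceptional
  variable, and leaves the division by \<open>E^(n-k)\<close>.
\<close>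

lemma algorithm_step_acts:
  fixes F F' :: "'a::field_char_0 fps fps fps"
  assumes "n > 1" "depressed_monic n F" "nu3 F = enat n" "nu3 F' = enat n" "algorithm_step F F'"
  obtains mv where "\<And>k. k \<le> n \<Longrightarrow> acts mv (n - k) (slice F k) (slice F' k)" "depressed_monic n F'"
proof -
  have "mult3 F = n" using assms(3) by (simp add: mult3_def)
  then obtain mv c where e: "exceptional mv ^ n * F' = chart_subst mv c F"
    using algorithm_step_chart [OF assms(5)] by metis
  then have "c = 0" using direction_Z_zero assms by blast
  then have eq: "mulX k (pullback mv (slice F k)) = mulX n (orient mv (slice F' k))" for k
    using slice_chart_subst [of mv F k] slice_exceptional_power [of mv n F' k] e by simp
  have act: "acts mv (n - k) (slice F k) (slice F' k)" if "k \<le> n" for k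
  proof -
    have "pullback mv (slice F k) i j = mulX (n - k) (orient mv (slice F' k)) i j" for i j
      using fun_cong [OF fun_cong [OF eq [of k]], of "i + k" j] that by (auto simp: mulX_def)
    then show ?thesis by (simp add: fun_eq_iff)
  qed
  have zero: "\<not> nonzero (slice F k) \<Longrightarrow> \<not> nonzero (slice F' k)" for k
    using arg_cong [OF eq [of k], of nonzero] by simp
  have "slice F' n = slice F n"
  proof -
    have "slice F n = (\<lambda>i j. if i = 0 \<and> j = 0 then 1 else 0)" (is "_ = ?d")
      using assms(2) by (simp add: depressed_monic_def)
    moreover have "pullback mv ?d = ?d" and "orient mv ?d = ?d"
    proof -
      have sw: "swap ?d = ?d" by (auto simp: swap_def fun_eq_iff)
      have ch: "chartX b ?d = ?d" for b :: 'a
      proof (intro ext)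
        fix d l
        have "chartX b ?d d l = (\<Sum>j\<le>d. if j = 0 then if d = 0 \<and> l = 0 then 1 else 0 else 0)"
          unfolding chartX_def by (intro sum.cong refl) (auto simp: binomial_eq_0)
        then show "chartX b ?d d l = ?d d l" by simp
      qed
      show "pullback mv ?d = ?d" "orient mv ?d = ?d"
        by (cases mv; simp only: pullback.simps orient.simps sw ch)+
    qed
    moreover have "mulX 0 g = g" for g :: "nat \<Rightarrow> nat \<Rightarrow> 'a" by (simp add: mulX_def fun_eq_iff)
    moreover have "orient mv (orient mv g) = g" for g :: "nat \<Rightarrow> nat \<Rightarrow> 'a" by (cases mv) simp_all
    ultimately show ?thesis using act [of n] by (metis acts_def diff_self_eq_0 le_refl)
  qed
  then have "depressed_monic n F'" using assms(2) zero by (auto simp: depressed_monic_def)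
  then show thesis using that act by blast
qed

section \<open>Quadrants\<close>

text \<open>
  Unless the series is \<open>0\<close>, its polyhedron is the hull of the lattice points of a translated quadrant. Every lattice point
  other than the corner is the midpoint of two of its lattice neighbours, so it is not extreme.
\<close>

lemma monomial_like_quadrant:
  assumes "monomial_like (coeff2 f)" shows "quadrant (newton_polyhedron f)"
proof (cases "\<forall>i j. coeff2 f i j = 0")
  case True
  then show ?thesis by (simp add: quadrant_def newton_polyhedron_def)
next
  case False
  then obtain p q where pq: "coeff2 f p q \<noteq> 0" and min: "\<And>i j. coeff2 f i j \<noteq> 0 \<Longrightarrow> p \<le> i \<and> q \<le> j"
    using assms unfolding monomial_like_def by blast
  define S where "S = {(real i, real j) |i j. p \<le> i \<and> q \<le> j}"
  have "(\<Union>(i, j) \<in> {(i, j). coeff2 f i j \<noteq> 0}. {(real (i + p), real (j + q)) |p q. True}) = S" (is "?U = S")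
  proof
    show "?U \<subseteq> S" unfolding S_def using min by (fastforce intro: trans_le_add1)
    show "S \<subseteq> ?U"
    proof
      fix x assume "x \<in> S"
      then obtain i j where ij: "x = (real i, real j)" "p \<le> i" "q \<le> j" by (auto simp: S_def)
      then have "x = (real (p + (i - p)), real (q + (j - q)))" by simp
      then show "x \<in> ?U" using pq by blast
    qed
  qed
  then have N: "newton_polyhedron f = convex hull S" by (simp add: newton_polyhedron_def)
  have inS: "(real i, real j) \<in> S" if "p \<le> i" "q \<le> j" for i j using that by (auto simp: S_def)
  let ?Q = "{real p..} \<times> {real q..}"
  have hull: "convex hull S \<subseteq> ?Q"
    by (rule hull_minimal) (auto simp: S_def intro: convex_Times)
  have "(real p, real q) extreme_point_of convex hull S"
    unfolding extreme_point_of_def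
  proof (intro conjI ballI notI)
    show "(real p, real q) \<in> convex hull S" using inS [of p q] hull_subset by (metis le_refl subsetD)
    fix a b assume ab: "a \<in> convex hull S" "b \<in> convex hull S" "(real p, real q) \<in> open_segment a b"
    then obtain t where "a \<noteq> b" "0 < t" "t < 1" and pt: "(real p, real q) = (1 - t) *\<^sub>R a + t *\<^sub>R b"
      by (auto simp: in_segment)
    obtain a1 a2 b1 b2 where c: "a = (a1, a2)" "b = (b1, b2)" by (cases a, cases b)
    have g: "a1 \<ge> real p" "a2 \<ge> real q" "b1 \<ge> real p" "b2 \<ge> real q" using hull ab c by auto
    have low: "a = y \<and> b = y" if "y = (1 - t) * a + t * b" "a \<ge> y" "b \<ge> y" for a b y :: real
    proof -
      have "(1 - t) * (a - y) + t * (b - y) = 0" using that(1) by (simp add: algebra_simps)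
      moreover have "0 \<le> (1 - t) * (a - y)" "0 \<le> t * (b - y)"
        using that \<open>0 < t\<close> \<open>t < 1\<close> by simp_all
      ultimately have "(1 - t) * (a - y) = 0" "t * (b - y) = 0" by linarith+
      then show ?thesis using \<open>0 < t\<close> \<open>t < 1\<close> by simp
    qed
    have "real p = (1 - t) * a1 + t * b1" "real q = (1 - t) * a2 + t * b2" using pt c by simp_all
    then have "a1 = b1" "a2 = b2" using low g by metis+
    then show False using \<open>a \<noteq> b\<close> c by simp
  qed
  moreover have "x = (real p, real q)" if x: "x extreme_point_of convex hull S" for x
  proof -
    have "x \<in> S" using x by (rule extreme_point_of_convex_hull)
    then obtain i j where ij: "x = (real i, real j)" "p \<le> i" "q \<le> j" by (auto simp: S_def)
    have no: False if "y \<in> S" "z \<in> S" "y \<noteq> z" "x = midpoint y z" for y z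
      using x that hull_inc [of _ S convex] unfolding extreme_point_of_def by (metis midpoint_in_open_segment)
    have "i = p"
    proof (rule ccontr)
      assume "i \<noteq> p"
      then have i: "p \<le> i - 1" "i \<ge> 1" using ij by auto
      have "x = midpoint (real (i - 1), real j) (real (i + 1), real j)"
        using i ij by (simp add: midpoint_def of_nat_diff)
      from no [OF inS inS _ this] show False using i ij by auto
    qed
    moreover have "j = q"
    proof (rule ccontr)
      assume "j \<noteq> q"
      then have j: "q \<le> j - 1" "j \<ge> 1" using ij by auto
      have "x = midpoint (real i, real (j - 1)) (real i, real (j + 1))"
        using j ij by (simp add: midpoint_def of_nat_diff)
      from no [OF inS inS _ this] show False using j ij by auto
    qed
    ultimately show ?thesis using ij by simp
  qed
  ultimately show ?thesis unfolding quadrant_def N by blast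
qed

text \<open>
  The transvection acts on the coefficients of all powers of \<open>Z\<close> by one and the same shear. Since the
  coefficients of \<open>Z^k\<close> for \<open>k \<le> n - 2\<close> are finitely many and \<open>n - k > 0\<close> for them,
  \<open>moves_reach_monomials\<close> applies.
\<close>

theorem proposition5:
  fixes n :: nat
    and F :: "'a::{alg_closed_field, field_char_0} fps fps fps"
    and Fs :: "nat \<Rightarrow> 'a fps fps fps"
  assumes "n > 1"
    and "WT_equation n F"
    and "initial_form F = varZ ^ n"
    and "Fs 0 = F"
    and "\<And>i. algorithm_step (Fs i) (Fs (Suc i))"
    and "\<And>i. nu3 (Fs i) = enat n"
  shows "\<exists>r \<phi>. transvection \<phi> \<and> (\<forall>k \<le> n - 2. quadrant (Gamma_polyhedron k (\<phi> (Fs r))))"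
proof -
  have dm: "depressed_monic n (Fs t)" for t
  proof (induct t)
    case 0
    show ?case using WT_depressed_monic assms by blast
  next
    case (Suc t)
    show ?case by (rule algorithm_step_acts [OF assms(1) Suc assms(6) assms(6) assms(5)])
  qed
  have "\<forall>t. \<exists>mv. \<forall>k\<le>n. acts mv (n - k) (slice (Fs t) k) (slice (Fs (Suc t)) k)"
    using algorithm_step_acts [OF assms(1) dm assms(6) assms(6) assms(5)] by metis
  then obtain mv where mv: "\<And>t k. k \<le> n \<Longrightarrow> acts (mv t) (n - k) (slice (Fs t) k) (slice (Fs (Suc t)) k)"
    by metis
  have "\<exists>r \<beta>. fps_nth \<beta> 0 = 0 \<and> (\<forall>k\<in>{..n - 2}. monomial_like (shearY \<beta> (slice (Fs r) k)))"
    by (rule moves_reach_monomials [where N = "\<lambda>k. n - k" and mv = mv]) (use mv assms(1) in auto)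
  then obtain r \<beta> where b0: "fps_nth \<beta> 0 = 0"
    and mon: "\<And>k. k \<le> n - 2 \<Longrightarrow> monomial_like (shearY \<beta> (slice (Fs r) k))" by auto
  let ?\<phi> = "subst3 varX (varY + fps_const (fps_const \<beta>)) varZ"
  have "quadrant (Gamma_polyhedron k (?\<phi> (Fs r)))" if "k \<le> n - 2" for k
  proof -
    have "coeff2 (fps_nth (?\<phi> (Fs r)) k) = shearY \<beta> (slice (Fs r) k)"
      unfolding slice_transvection [OF b0, symmetric] by (simp add: fun_eq_iff coeff2_def slice_def coeff3_def)
    then show ?thesis unfolding Gamma_polyhedron_def using mon [OF that] monomial_like_quadrant by metis
  qed
  moreover have "transvection ?\<phi>" using b0 unfolding transvection_def by blast
  ultimately show ?thesis by blast
qed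

end
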